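(* Suppose that for every $X\subseteq V$ the vectors $Y_X$ and $Y_{V\setminus X}$ are conditionally independent given $L_U$. Then for every integer $1\le N\le|V|$, $$\mathop{\arg\min}_{X\subseteq V:\,|X|=N}H(Y_{V_t\setminus X_t}|Y_X)\;=\;\mathop{\arg\max}_{X\subseteq V:\,|X|=N}\Big(H(Y_{X_t}|L_U)-I(L_U;Y_{V_t\setminus X_t}|Y_X)\Big),$$ where $I(L_U;Y_{V_t\setminus X_t}|Y_X)=H(L_U|Y_X)-H(L_U|Y_{X\cup (V_t\setminus X_t)})$.
   Context: $V=\bigcup_{i=1}^M V_i$ is a finite set of tuples $\langle x,i\rangle$ (location $x$, measurement type $i$), where $V_i$ is the set of those tuples with type $i$; $t\in\{1,\ldots,M\}$ is a fixed target type; for $X\subseteq V$, $X_t=X\cap V_t$. $Y_V=(Y_{\langle x,i\rangle})_{\langle x,i\rangle\in V}$ are the measurements and $L_U$ is a finite vector of latent (inducing) measurements; in the sparse multi-output Gaussian process model, $(L_U,Y_V)$ is jointly Gaussian with nondegenerate covariance. For $A\subseteq V$, $Y_A$ is the subvector indexed by $A$. $H(\cdot|\cdot)$ is conditional differential entropy under this joint law, with the entropy of an empty vector equal to $0$. *)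

theory Defs
  imports "HOL-Probability.Probability"
begin

definition of_type :: "('x \<times> nat) set \<Rightarrow> nat \<Rightarrow> ('x \<times> nat) set"
  where "of_type X i = {v \<in> X. snd v = i}"

section \<open>Finite real random vectors\<close>

text \<open>
  Vectors indexed by a finite set \<open>A\<close> live in the product space over \<open>A\<close>, whose elements are
  \<open>undefined\<close> outside \<open>A\<close>. For \<open>A = {}\<close> this space is a single point of mass \<open>1\<close>.
\<close>

abbreviation lebesgue_on_index :: "'i set \<Rightarrow> ('i \<Rightarrow> real) measure"
  where "lebesgue_on_index A \<equiv> PiM A (\<lambda>_. lborel)"

definition subvec :: "('i \<Rightarrow> 'a \<Rightarrow> real) \<Rightarrow> 'i set \<Rightarrow> 'a \<Rightarrow> 'i \<Rightarrow> real"
  where "subvec Z A = (\<lambda>\<omega>. \<lambda>i\<in>A. Z i \<omega>)"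

section \<open>Nondegenerate Gaussian vectors\<close>

text \<open>Matrices are functions of two indices, of which only the values on \<open>I \<times> I\<close> matter.\<close>

definition det_on :: "'i set \<Rightarrow> ('i \<Rightarrow> 'i \<Rightarrow> real) \<Rightarrow> real"
  where "det_on I K = (\<Sum>p | p permutes I. of_int (sign p) * (\<Prod>i\<in>I. K i (p i)))"

definition quad_form_on :: "'i set \<Rightarrow> ('i \<Rightarrow> 'i \<Rightarrow> real) \<Rightarrow> ('i \<Rightarrow> real) \<Rightarrow> real"
  where "quad_form_on I K a = (\<Sum>i\<in>I. \<Sum>j\<in>I. a i * K i j * a j)"

definition pos_def_on :: "'i set \<Rightarrow> ('i \<Rightarrow> 'i \<Rightarrow> real) \<Rightarrow> bool"
  where "pos_def_on I K \<longleftrightarrow> (\<forall>i\<in>I. \<forall>j\<in>I. K i j = K j i) \<and>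
    (\<forall>a. (\<exists>i\<in>I. a i \<noteq> 0) \<longrightarrow> 0 < quad_form_on I K a)"

definition inverse_on :: "'i set \<Rightarrow> ('i \<Rightarrow> 'i \<Rightarrow> real) \<Rightarrow> ('i \<Rightarrow> 'i \<Rightarrow> real) \<Rightarrow> bool"
  where "inverse_on I K Q \<longleftrightarrow>
    (\<forall>i\<in>I. \<forall>j\<in>I. (\<Sum>k\<in>I. K i k * Q k j) = (if i = j then 1 else 0) \<and>
      (\<Sum>k\<in>I. Q i k * K k j) = (if i = j then 1 else 0))"

text \<open>
  \<open>Q\<close> is the inverse of the covariance matrix \<open>K\<close>; it exists and is unique on \<open>I\<close> because \<open>K\<close> is
  positive definite.
\<close>

definition nondegenerate_gaussian :: "'a measure \<Rightarrow> 'i set \<Rightarrow> ('i \<Rightarrow> 'a \<Rightarrow> real) \<Rightarrow> bool"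
  where "nondegenerate_gaussian P I Z \<longleftrightarrow>
    (\<exists>\<mu> K Q. pos_def_on I K \<and> inverse_on I K Q \<and>
      distributed P (lebesgue_on_index I) (subvec Z I)
        (\<lambda>z. ennreal (exp (- quad_form_on I Q (\<lambda>i. z i - \<mu> i) / 2) /
               sqrt ((2 * pi) ^ card I * det_on I K))))"

section \<open>Conditional independence\<close>

definition cond_prob :: "'a measure \<Rightarrow> 'c measure \<Rightarrow> ('a \<Rightarrow> 'c) \<Rightarrow> 'a set \<Rightarrow> 'a \<Rightarrow> real"
  where "cond_prob P S Z E = real_cond_exp P (vimage_algebra (space P) Z S) (indicator E)"

definition cond_indep :: "'a measure \<Rightarrow> 'i set \<Rightarrow> ('i \<Rightarrow> 'a \<Rightarrow> real) \<Rightarrow>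
    'j set \<Rightarrow> ('j \<Rightarrow> 'a \<Rightarrow> real) \<Rightarrow> 'k set \<Rightarrow> ('k \<Rightarrow> 'a \<Rightarrow> real) \<Rightarrow> bool"
  where "cond_indep P A X B Y C Z \<longleftrightarrow>
    (\<forall>E\<in>sets (lebesgue_on_index A). \<forall>F\<in>sets (lebesgue_on_index B).
      let XE = subvec X A -` E \<inter> space P;
          YF = subvec Y B -` F \<inter> space P;
          cp = cond_prob P (lebesgue_on_index C) (subvec Z C)
      in AE \<omega> in P. cp (XE \<inter> YF) \<omega> = cp XE \<omega> * cp YF \<omega>)"

section \<open>Conditional differential entropy and mutual information\<close>

text \<open>
  Natural logarithms. Since the reference measure on the empty index set is a unit point mass, the
  library's definition yields \<open>0\<close> for the entropy of an empty vector and the unconditional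
  entropy when the conditioning vector is empty.
\<close>

definition cond_entropy :: "'a measure \<Rightarrow> 'i set \<Rightarrow> ('i \<Rightarrow> 'a \<Rightarrow> real) \<Rightarrow>
    'j set \<Rightarrow> ('j \<Rightarrow> 'a \<Rightarrow> real) \<Rightarrow> real"
  where "cond_entropy P A X B Y =
    prob_space.conditional_entropy P (exp 1) (lebesgue_on_index A) (lebesgue_on_index B)
      (subvec X A) (subvec Y B)"

text \<open>\<open>I(L\<^sub>U ; Y\<^sub>A | Y\<^sub>B) = H(L\<^sub>U | Y\<^sub>B) - H(L\<^sub>U | Y\<^bsub>B \<union> A\<^esub>)\<close>\<close>

definition cond_mutual_info :: "'a measure \<Rightarrow> 'u set \<Rightarrow> ('u \<Rightarrow> 'a \<Rightarrow> real) \<Rightarrow>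
    ('i \<Rightarrow> 'a \<Rightarrow> real) \<Rightarrow> 'i set \<Rightarrow> 'i set \<Rightarrow> real"
  where "cond_mutual_info P U L Y A B =
    cond_entropy P U L B Y - cond_entropy P U L (B \<union> A) Y"

section \<open>Consistency with the library\<close>

lemma nondegenerate_gaussian_density_singleton:
  assumes "0 < \<sigma>" and "K i i = \<sigma>\<^sup>2" and "inverse_on {i} K Q"
  shows "exp (- quad_form_on {i} Q (\<lambda>i. z i - \<mu> i) / 2) / sqrt ((2 * pi) ^ card {i} * det_on {i} K)
    = normal_density (\<mu> i) \<sigma> (z i)"
proof -
  have "Q i i = 1 / \<sigma>\<^sup>2"
    using assms by (auto simp: inverse_on_def field_simps)
  then have "- quad_form_on {i} Q (\<lambda>i. z i - \<mu> i) / 2 = - (z i - \<mu> i)\<^sup>2 / (2 * \<sigma>\<^sup>2)"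
    by (simp add: quad_form_on_def power2_eq_square)
  moreover have "det_on {i} K = \<sigma>\<^sup>2"
    using assms by (simp add: det_on_def permutes_sing)
  ultimately show ?thesis
    unfolding normal_density_def by simp
qed

lemma entropy_empty_vector:
  assumes "prob_space P"
  shows "prob_space.entropy P (exp 1) (lebesgue_on_index {}) (subvec X {}) = 0"
proof -
  interpret prob_space P by fact
  interpret S: sigma_finite_measure "lebesgue_on_index {}"
    by (simp add: PiM_empty sigma_finite_measure_count_space_finite)
  have eq: "distr P (lebesgue_on_index {}) (subvec X {}) = lebesgue_on_index {}"
  proof (rule measure_eqI)
    fix A assume "A \<in> sets (distr P (lebesgue_on_index {}) (subvec X {}))"
    then have "A = {} \<or> A = {\<lambda>_. undefined}"
      by (auto simp: PiM_empty)
    moreover have "subvec X {} \<in> measurable P (lebesgue_on_index {})"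
      unfolding subvec_def by (rule measurable_restrict) simp
    ultimately show "emeasure (distr P (lebesgue_on_index {}) (subvec X {})) A =
        emeasure (lebesgue_on_index {}) A"
      by (auto simp: emeasure_distr PiM_empty subvec_def restrict_def emeasure_space_1
          vimage_def)
  qed simp
  show ?thesis
    unfolding entropy_def eq S.KL_same_eq_0 by simp
qed

end

theory Submission
  imports Defs
begin

text \<open>
  Write \<open>e K\<close> for the differential entropy of the subvector of \<open>(L\<^sub>U, Y\<^sub>V)\<close> with index set \<open>K\<close>. All
  conditional entropies involved are differences of such (finite) numbers, and conditional
  independence of \<open>Y\<^sub>A\<close> and \<open>Y\<^sub>B\<close> given \<open>L\<^sub>U\<close> reads
  \<open>e (U \<union> A \<union> B) + e U = e (U \<union> A) + e (U \<union> B)\<close>. Using this for the pairs \<open>(X, V\<^sub>t - X\<^sub>t)\<close> and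
  \<open>(X\<^sub>t, V\<^sub>t - X\<^sub>t)\<close>, the two objective functions add up to the constant
  \<open>e (U \<union> V\<^sub>t) - e U = H(Y\<^bsub>V\<^sub>t\<^esub>|L\<^sub>U)\<close>.

  Marginal densities are never computed: the Gaussian density lies between two isotropic Gaussian
  functions, this is inherited by marginals, and it makes the logarithm of every marginal density
  integrable.
\<close>

section \<open>Transport of densities along coordinate maps\<close>

interpretation lborel_product: product_sigma_finite "\<lambda>_::'i. lborel :: real measure" ..

definition measure_iso :: "'b measure \<Rightarrow> 'c measure \<Rightarrow> ('b \<Rightarrow> 'c) \<Rightarrow> ('c \<Rightarrow> 'b) \<Rightarrow> bool"
  where "measure_iso M S \<phi> \<psi> \<longleftrightarrow> \<phi> \<in> measurable M S \<and> \<psi> \<in> measurable S M \<and>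
    (\<forall>z\<in>space M. \<psi> (\<phi> z) = z) \<and> distr M S \<phi> = S"

lemma distributed_measure_iso:
  assumes Z: "distributed P M Z f" and iso: "measure_iso M S \<phi> \<psi>"
  shows "distributed P S (\<lambda>\<omega>. \<phi> (Z \<omega>)) (\<lambda>s. f (\<psi> s))"
proof -
  have [measurable]: "\<phi> \<in> measurable M S" "\<psi> \<in> measurable S M"
    "Z \<in> measurable P M" "f \<in> borel_measurable M"
    and inv: "\<And>z. z \<in> space M \<Longrightarrow> \<psi> (\<phi> z) = z" and S: "distr M S \<phi> = S"
    using iso Z by (auto simp: measure_iso_def distributed_def)
  have "density S (\<lambda>s. f (\<psi> s)) = density (distr M S \<phi>) (\<lambda>s. f (\<psi> s))"
    by (simp add: S)
  also have "\<dots> = distr (density M (\<lambda>z. f (\<psi> (\<phi> z)))) S \<phi>"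
    by (rule density_distr) measurable
  also have "density M (\<lambda>z. f (\<psi> (\<phi> z))) = density M f"
    by (intro density_cong) (auto simp: inv)
  also have "density M f = distr P M Z"
    using Z by (simp add: distributed_def)
  also have "distr (distr P M Z) S \<phi> = distr P S (\<lambda>\<omega>. \<phi> (Z \<omega>))"
    by (simp add: distr_distr comp_def)
  finally show ?thesis
    by (simp add: distributed_def)
qed

lemma measure_iso_reindex:
  assumes A: "finite A" and p: "inj_on p A"
  shows "measure_iso (lebesgue_on_index (p ` A)) (lebesgue_on_index A)
    (\<lambda>z. \<lambda>i\<in>A. z (p i)) (\<lambda>x. \<lambda>k\<in>p ` A. x (inv_into A p k))"
proof -
  let ?\<phi> = "\<lambda>z. \<lambda>i\<in>A. z (p i)"
  have \<phi>[measurable]: "?\<phi> \<in> measurable (lebesgue_on_index (p ` A)) (lebesgue_on_index A)"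
    by (intro measurable_restrict) measurable
  have \<psi>: "(\<lambda>x. \<lambda>k\<in>p ` A. x (inv_into A p k)) \<in>
      measurable (lebesgue_on_index A) (lebesgue_on_index (p ` A))"
  proof (intro measurable_restrict)
    fix k assume "k \<in> p ` A"
    then have "inv_into A p k \<in> A" by (rule inv_into_into)
    then show "(\<lambda>x. x (inv_into A p k)) \<in> measurable (lebesgue_on_index A) lborel" by measurable
  qed
  have inv: "(\<lambda>k\<in>p ` A. ?\<phi> z (inv_into A p k)) = z"
    if "z \<in> space (lebesgue_on_index (p ` A))" for z :: "'b \<Rightarrow> real"
    using that p by (auto simp: space_PiM PiE_def extensional_def restrict_def fun_eq_iff)
  have "distr (lebesgue_on_index (p ` A)) (lebesgue_on_index A) ?\<phi> = lebesgue_on_index A"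
  proof (rule lborel_product.PiM_eqI[OF A])
    fix E :: "'a \<Rightarrow> real set" assume E: "\<And>i. i \<in> A \<Longrightarrow> E i \<in> sets lborel"
    have pre: "?\<phi> -` Pi\<^sub>E A E \<inter> space (lebesgue_on_index (p ` A)) =
        Pi\<^sub>E (p ` A) (\<lambda>k. E (inv_into A p k))"
      using p by (auto simp: space_PiM PiE_def Pi_def)
    have "emeasure (distr (lebesgue_on_index (p ` A)) (lebesgue_on_index A) ?\<phi>) (Pi\<^sub>E A E) =
        emeasure (lebesgue_on_index (p ` A)) (Pi\<^sub>E (p ` A) (\<lambda>k. E (inv_into A p k)))"
      using A E by (subst emeasure_distr) (auto simp: pre intro!: sets_PiM_I_finite)
    also have "\<dots> = (\<Prod>k\<in>p ` A. emeasure lborel (E (inv_into A p k)))"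
      using A E p by (intro lborel_product.emeasure_PiM) auto
    also have "\<dots> = (\<Prod>i\<in>A. emeasure lborel (E i))"
      using p by (simp add: prod.reindex)
    finally show "emeasure (distr (lebesgue_on_index (p ` A)) (lebesgue_on_index A) ?\<phi>) (Pi\<^sub>E A E) =
        (\<Prod>i\<in>A. emeasure lborel (E i))" .
  qed simp
  then show ?thesis
    unfolding measure_iso_def using \<phi> \<psi> inv by blast
qed

lemma sigma_finite_lebesgue_on_index:
  "finite A \<Longrightarrow> sigma_finite_measure (lebesgue_on_index A)"
  by (rule lborel_product.sigma_finite)

lemma measure_iso_pair:
  assumes K: "finite K" "finite K'" "K \<inter> K' = {}"
    and iso: "measure_iso (lebesgue_on_index K) S \<phi> \<psi>"
    and iso': "measure_iso (lebesgue_on_index K') S' \<phi>' \<psi>'"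
    and S: "sigma_finite_measure S" and S': "sigma_finite_measure S'"
  shows "measure_iso (lebesgue_on_index (K \<union> K')) (S \<Otimes>\<^sub>M S')
    (\<lambda>z. (\<phi> (restrict z K), \<phi>' (restrict z K'))) (\<lambda>(x, y). merge K K' (\<psi> x, \<psi>' y))"
proof -
  let ?M = "lebesgue_on_index K" and ?M' = "lebesgue_on_index K'"
  let ?g = "\<lambda>z. (\<phi> (restrict z K), \<phi>' (restrict z K'))"
  interpret M': sigma_finite_measure ?M' using K by (intro sigma_finite_lebesgue_on_index)
  have [measurable]: "\<phi> \<in> measurable ?M S" "\<psi> \<in> measurable S ?M"
      "\<phi>' \<in> measurable ?M' S'" "\<psi>' \<in> measurable S' ?M'"
    and inv: "\<And>z. z \<in> space ?M \<Longrightarrow> \<psi> (\<phi> z) = z" "\<And>z. z \<in> space ?M' \<Longrightarrow> \<psi>' (\<phi>' z) = z"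
    and d: "distr ?M S \<phi> = S" "distr ?M' S' \<phi>' = S'"
    using iso iso' by (auto simp: measure_iso_def)
  have [measurable]: "(\<lambda>z. restrict z K) \<in> measurable (lebesgue_on_index (K \<union> K')) ?M"
    "(\<lambda>z. restrict z K') \<in> measurable (lebesgue_on_index (K \<union> K')) ?M'"
    by (auto intro: measurable_restrict_subset)
  have g[measurable]: "?g \<in> measurable (lebesgue_on_index (K \<union> K')) (S \<Otimes>\<^sub>M S')"
    by measurable
  have m: "(\<lambda>(x, y). merge K K' (\<psi> x, \<psi>' y)) \<in> measurable (S \<Otimes>\<^sub>M S') (lebesgue_on_index (K \<union> K'))"
    by measurable
  have i: "merge K K' (\<psi> (\<phi> (restrict z K)), \<psi>' (\<phi>' (restrict z K'))) = z"
    if z: "z \<in> space (lebesgue_on_index (K \<union> K'))" for z :: "'a \<Rightarrow> real"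
  proof -
    have "restrict z K \<in> space ?M" "restrict z K' \<in> space ?M'"
      using z by (auto simp: space_PiM)
    then show ?thesis
      using z by (auto simp: inv merge_def space_PiM PiE_def extensional_def fun_eq_iff)
  qed
  have "S \<Otimes>\<^sub>M S' = distr (lebesgue_on_index (K \<union> K')) (S \<Otimes>\<^sub>M S') ?g"
  proof (rule pair_measure_eqI[OF S S'])
    fix E F assume [measurable]: "E \<in> sets S" "F \<in> sets S'"
    have eq: "(\<lambda>w. ?g (merge K K' w)) -` (E \<times> F) \<inter> space (?M \<Otimes>\<^sub>M ?M') =
        (\<phi> -` E \<inter> space ?M) \<times> (\<phi>' -` F \<inter> space ?M')"
      using K by (auto simp: space_pair_measure space_PiM)
    have "distr (lebesgue_on_index (K \<union> K')) (S \<Otimes>\<^sub>M S') ?g =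
        distr (distr (?M \<Otimes>\<^sub>M ?M') (lebesgue_on_index (K \<union> K')) (merge K K')) (S \<Otimes>\<^sub>M S') ?g"
      using K by (simp add: lborel_product.distr_merge)
    also have "\<dots> = distr (?M \<Otimes>\<^sub>M ?M') (S \<Otimes>\<^sub>M S') (\<lambda>w. ?g (merge K K' w))"
      by (subst distr_distr) (auto simp: comp_def)
    finally have "emeasure (distr (lebesgue_on_index (K \<union> K')) (S \<Otimes>\<^sub>M S') ?g) (E \<times> F) =
        emeasure (?M \<Otimes>\<^sub>M ?M') ((\<phi> -` E \<inter> space ?M) \<times> (\<phi>' -` F \<inter> space ?M'))"
      by (simp add: emeasure_distr eq)
    also have "\<dots> = emeasure (distr ?M S \<phi>) E * emeasure (distr ?M' S' \<phi>') F"
      by (simp add: M'.emeasure_pair_measure_Times emeasure_distr)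
    finally show "emeasure S E * emeasure S' F =
        emeasure (distr (lebesgue_on_index (K \<union> K')) (S \<Otimes>\<^sub>M S') ?g) (E \<times> F)"
      by (simp add: d)
  qed simp
  then show ?thesis
    unfolding measure_iso_def using g m i by auto
qed

section \<open>Densities with Gaussian upper and lower bounds\<close>

definition dist_sq_on :: "'i set \<Rightarrow> ('i \<Rightarrow> real) \<Rightarrow> ('i \<Rightarrow> real) \<Rightarrow> real"
  where "dist_sq_on K \<mu> z = (\<Sum>k\<in>K. (z k - \<mu> k)\<^sup>2)"

lemma dist_sq_on_nonneg: "0 \<le> dist_sq_on K \<mu> z"
  by (simp add: dist_sq_on_def sum_nonneg)

lemma borel_measurable_dist_sq_on [measurable]:
  "dist_sq_on K \<mu> \<in> borel_measurable (lebesgue_on_index K)"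
  unfolding dist_sq_on_def by measurable

lemma dist_sq_on_merge:
  assumes "finite J" "finite K" "J \<inter> K = {}"
  shows "dist_sq_on (J \<union> K) \<mu> (merge J K (x, y)) = dist_sq_on J \<mu> x + dist_sq_on K \<mu> y"
proof -
  have "(\<Sum>k\<in>J. (merge J K (x, y) k - \<mu> k)\<^sup>2) = (\<Sum>k\<in>J. (x k - \<mu> k)\<^sup>2)"
    by (intro sum.cong) (auto simp: merge_def)
  moreover have "(\<Sum>k\<in>K. (merge J K (x, y) k - \<mu> k)\<^sup>2) = (\<Sum>k\<in>K. (y k - \<mu> k)\<^sup>2)"
    using assms by (intro sum.cong) (auto simp: merge_def)
  ultimately show ?thesis
    using assms by (simp add: dist_sq_on_def sum.union_disjoint)
qed

lemma nn_integral_exp_square: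
  fixes d m :: real
  assumes "0 < d"
  shows "(\<integral>\<^sup>+x. ennreal (exp (- d * (x - m)\<^sup>2)) \<partial>lborel) = ennreal (sqrt (pi / d))"
proof -
  define \<sigma> where "\<sigma> = 1 / sqrt (2 * d)"
  have \<sigma>: "0 < \<sigma>" "\<sigma>\<^sup>2 = 1 / (2 * d)"
    using assms by (auto simp: \<sigma>_def power_divide)
  have eq: "exp (- d * (x - m)\<^sup>2) = sqrt (pi / d) * normal_density m \<sigma> x" for x
    using assms by (simp add: normal_density_def \<sigma>)
  interpret prob_space "density lborel (normal_density m \<sigma>)"
    using \<sigma>(1) by (rule prob_space_normal_density)
  have "(\<integral>\<^sup>+x. ennreal (normal_density m \<sigma> x) \<partial>lborel) = 1"
    using emeasure_space_1 by (simp add: emeasure_density)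
  then show ?thesis
    using assms unfolding eq by (simp add: ennreal_mult nn_integral_cmult normal_density_nonneg)
qed

lemma nn_integral_exp_dist_sq_on:
  assumes K: "finite K" and d: "0 < d"
  shows "(\<integral>\<^sup>+z. ennreal (exp (- d * dist_sq_on K \<mu> z)) \<partial>lebesgue_on_index K) =
    ennreal (sqrt (pi / d) ^ card K)"
proof -
  have "exp (- d * dist_sq_on K \<mu> z) = (\<Prod>k\<in>K. exp (- d * (z k - \<mu> k)\<^sup>2))" for z
    using K by (simp add: dist_sq_on_def sum_distrib_left flip: exp_sum sum_negf)
  then have "(\<integral>\<^sup>+z. ennreal (exp (- d * dist_sq_on K \<mu> z)) \<partial>lebesgue_on_index K) =
      (\<integral>\<^sup>+z. (\<Prod>k\<in>K. ennreal (exp (- d * (z k - \<mu> k)\<^sup>2))) \<partial>lebesgue_on_index K)"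
    by (simp add: prod_ennreal)
  also have "\<dots> = (\<Prod>k\<in>K. \<integral>\<^sup>+x. ennreal (exp (- d * (x - \<mu> k)\<^sup>2)) \<partial>lborel)"
    using K by (intro lborel_product.product_nn_integral_prod) auto
  also have "\<dots> = ennreal (sqrt (pi / d) ^ card K)"
    unfolding nn_integral_exp_square[OF d] using d by (simp add: ennreal_power)
  finally show ?thesis .
qed

definition gaussian_bounds :: "'i set \<Rightarrow> (('i \<Rightarrow> real) \<Rightarrow> ennreal) \<Rightarrow> bool"
  where "gaussian_bounds K f \<longleftrightarrow>
    (\<exists>\<mu> a b c d. 0 < a \<and> 0 < b \<and> 0 < c \<and> 0 < d \<and>
      (\<forall>z\<in>space (lebesgue_on_index K).
        ennreal (a * exp (- b * dist_sq_on K \<mu> z)) \<le> f z \<and>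
        f z \<le> ennreal (c * exp (- d * dist_sq_on K \<mu> z))))"

lemma gaussian_bounds_pos_finite:
  assumes "gaussian_bounds K f" and z: "z \<in> space (lebesgue_on_index K)"
  shows "0 < f z" "f z < \<infinity>"
proof -
  obtain \<mu> a b c d where "0 < a"
    and lo: "ennreal (a * exp (- b * dist_sq_on K \<mu> z)) \<le> f z"
    and hi: "f z \<le> ennreal (c * exp (- d * dist_sq_on K \<mu> z))"
    using assms unfolding gaussian_bounds_def by blast
  have "0 < ennreal (a * exp (- b * dist_sq_on K \<mu> z))"
    using \<open>0 < a\<close> by simp
  then show "0 < f z" using lo by (rule less_le_trans)
  show "f z < \<infinity>" using hi by (rule le_less_trans) simp
qed

lemma gaussian_bounds_marginal:
  assumes J: "finite J" and K: "finite K" and JK: "J \<inter> K = {}"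
    and f: "gaussian_bounds (J \<union> K) f"
  shows "gaussian_bounds J (\<lambda>x. \<integral>\<^sup>+y. f (merge J K (x, y)) \<partial>lebesgue_on_index K)"
proof -
  obtain \<mu> a b c d where pos: "0 < a" "0 < b" "0 < c" "0 < d"
    and bounds: "\<forall>z\<in>space (lebesgue_on_index (J \<union> K)).
      ennreal (a * exp (- b * dist_sq_on (J \<union> K) \<mu> z)) \<le> f z \<and>
      f z \<le> ennreal (c * exp (- d * dist_sq_on (J \<union> K) \<mu> z))"
    using f unfolding gaussian_bounds_def by blast
  note lo = bounds[rule_format, THEN conjunct1] and hi = bounds[rule_format, THEN conjunct2]
  have merge: "merge J K (x, y) \<in> space (lebesgue_on_index (J \<union> K))"
    if "x \<in> space (lebesgue_on_index J)" "y \<in> space (lebesgue_on_index K)" for x y :: "'a \<Rightarrow> real"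
    using that by (auto simp: space_PiM PiE_def)
  have int: "(\<integral>\<^sup>+y. ennreal (e * exp (- s * dist_sq_on (J \<union> K) \<mu> (merge J K (x, y))))
        \<partial>lebesgue_on_index K) =
      ennreal (e * sqrt (pi / s) ^ card K * exp (- s * dist_sq_on J \<mu> x))"
    if "0 < e" "0 < s" for e s and x :: "'a \<Rightarrow> real"
  proof -
    have "e * exp (- s * dist_sq_on (J \<union> K) \<mu> (merge J K (x, y))) =
        (e * exp (- s * dist_sq_on J \<mu> x)) * exp (- s * dist_sq_on K \<mu> y)" for y
      using J K JK by (simp add: dist_sq_on_merge algebra_simps flip: exp_add)
    then have "(\<integral>\<^sup>+y. ennreal (e * exp (- s * dist_sq_on (J \<union> K) \<mu> (merge J K (x, y))))
          \<partial>lebesgue_on_index K) =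
        (\<integral>\<^sup>+y. ennreal (e * exp (- s * dist_sq_on J \<mu> x)) * ennreal (exp (- s * dist_sq_on K \<mu> y))
          \<partial>lebesgue_on_index K)"
      using that by (simp add: ennreal_mult mult.assoc)
    also have "\<dots> = ennreal (e * exp (- s * dist_sq_on J \<mu> x)) * ennreal (sqrt (pi / s) ^ card K)"
      using nn_integral_exp_dist_sq_on[OF K \<open>0 < s\<close>, of \<mu>] by (subst nn_integral_cmult) auto
    also have "\<dots> = ennreal (e * sqrt (pi / s) ^ card K * exp (- s * dist_sq_on J \<mu> x))"
      using that by (simp add: ennreal_mult[symmetric] mult_ac)
    finally show ?thesis .
  qed
  show ?thesis
    unfolding gaussian_bounds_def
  proof (intro exI conjI ballI)
    show "0 < a * sqrt (pi / b) ^ card K" "0 < b" "0 < c * sqrt (pi / d) ^ card K" "0 < d"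
      using pos by auto
    fix x :: "'a \<Rightarrow> real" assume x: "x \<in> space (lebesgue_on_index J)"
    show "ennreal (a * sqrt (pi / b) ^ card K * exp (- b * dist_sq_on J \<mu> x)) \<le>
        (\<integral>\<^sup>+y. f (merge J K (x, y)) \<partial>lebesgue_on_index K)"
      unfolding int[OF pos(1,2), symmetric] by (intro nn_integral_mono lo merge x)
    show "(\<integral>\<^sup>+y. f (merge J K (x, y)) \<partial>lebesgue_on_index K) \<le>
        ennreal (c * sqrt (pi / d) ^ card K * exp (- d * dist_sq_on J \<mu> x))"
      unfolding int[OF pos(3,4), symmetric] by (intro nn_integral_mono hi merge x)
  qed
qed

lemma gaussian_bounds_integrable_ln:
  assumes K: "finite K" and Z: "distributed P (lebesgue_on_index K) Z f" and f: "gaussian_bounds K f"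
  shows "integrable P (\<lambda>\<omega>. ln (enn2real (f (Z \<omega>))))"
proof -
  have [measurable]: "Z \<in> measurable P (lebesgue_on_index K)"
    "f \<in> borel_measurable (lebesgue_on_index K)"
    using Z by (auto simp: distributed_def)
  obtain \<mu> a b c d where pos: "0 < a" "0 < b" "0 < c" "0 < d"
    and bounds: "\<forall>z\<in>space (lebesgue_on_index K).
      ennreal (a * exp (- b * dist_sq_on K \<mu> z)) \<le> f z \<and>
      f z \<le> ennreal (c * exp (- d * dist_sq_on K \<mu> z))"
    using f unfolding gaussian_bounds_def by blast
  note lo = bounds[rule_format, THEN conjunct1] and hi = bounds[rule_format, THEN conjunct2]
  define A where "A = \<bar>ln a\<bar> + \<bar>ln c\<bar>"
  define C where "C = c * (A + (b + d) * (2 / d))"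
  have "0 \<le> A" by (simp add: A_def)
  then have "0 \<le> C" using pos by (simp add: C_def)
  have bound: "f z * ennreal \<bar>ln (enn2real (f z))\<bar> \<le>
      ennreal C * ennreal (exp (- (d / 2) * dist_sq_on K \<mu> z))"
    if z: "z \<in> space (lebesgue_on_index K)" for z
  proof -
    define s where "s = dist_sq_on K \<mu> z"
    have s: "0 \<le> s" by (simp add: s_def dist_sq_on_nonneg)
    define r where "r = enn2real (f z)"
    have r: "f z = ennreal r" "0 < r"
      using gaussian_bounds_pos_finite[OF f z] by (auto simp: r_def enn2real_positive_iff)
    have r_lo: "a * exp (- b * s) \<le> r" and r_hi: "r \<le> c * exp (- d * s)"
      using lo[OF z] hi[OF z] pos r(2) unfolding r(1) s_def[symmetric] by auto
    have "ln a - b * s = ln (a * exp (- b * s))"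
      using pos by (simp add: ln_mult)
    also have "\<dots> \<le> ln r" using r_lo pos r(2) by simp
    finally have 1: "ln a - b * s \<le> ln r" .
    have "ln r \<le> ln (c * exp (- d * s))" using r_hi pos r(2) by simp
    also have "\<dots> = ln c - d * s" using pos by (simp add: ln_mult)
    finally have 2: "ln r \<le> ln c - d * s" .
    have bs: "0 \<le> b * s" "0 \<le> d * s" using pos s by auto
    have "\<bar>ln r\<bar> \<le> A + (b + d) * s"
      using 1 2 bs unfolding A_def distrib_right by linarith
    also have "\<dots> \<le> (A + (b + d) * (2 / d)) * exp (d / 2 * s)"
    proof -
      have "A \<le> A * exp (d / 2 * s)"
        using \<open>0 \<le> A\<close> pos s by (simp add: mult_le_cancel_left1)
      moreover have "s \<le> 2 / d * exp (d / 2 * s)"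
        using exp_ge_add_one_self[of "d / 2 * s"] pos by (simp add: field_simps)
      then have "(b + d) * s \<le> (b + d) * (2 / d * exp (d / 2 * s))"
        using pos by (intro mult_left_mono) auto
      ultimately show ?thesis by (simp add: algebra_simps)
    qed
    finally have "r * \<bar>ln r\<bar> \<le> (c * exp (- d * s)) * ((A + (b + d) * (2 / d)) * exp (d / 2 * s))"
      using r_hi r(2) pos by (intro mult_mono) auto
    also have "\<dots> = C * exp (- (d / 2) * s)"
    proof -
      have "exp (- d * s) * exp (d / 2 * s) = exp (- (d / 2) * s)"
        by (simp add: field_simps flip: exp_add)
      then show ?thesis by (simp add: C_def mult_ac)
    qed
    finally show ?thesis
      using \<open>0 \<le> C\<close> r(2) by (simp add: r(1) s_def[symmetric] ennreal_mult[symmetric])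
  qed
  have "(\<integral>\<^sup>+\<omega>. ennreal \<bar>ln (enn2real (f (Z \<omega>)))\<bar> \<partial>P) =
      (\<integral>\<^sup>+z. f z * ennreal \<bar>ln (enn2real (f z))\<bar> \<partial>lebesgue_on_index K)"
    by (intro distributed_nn_integral[OF Z, symmetric]) measurable
  also have "\<dots> \<le> (\<integral>\<^sup>+z. ennreal C * ennreal (exp (- (d / 2) * dist_sq_on K \<mu> z)) \<partial>lebesgue_on_index K)"
    by (intro nn_integral_mono bound)
  also have "\<dots> = ennreal C * ennreal (sqrt (pi / (d / 2)) ^ card K)"
    using nn_integral_exp_dist_sq_on[OF K, of "d / 2" \<mu>] pos by (subst nn_integral_cmult) auto
  also have "\<dots> < \<infinity>"
    by (simp add: ennreal_mult_less_top)
  finally show ?thesis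
    by (intro integrableI_bounded) auto
qed

lemma quad_form_on_ge_coordinate:
  assumes I: "finite I" and K: "pos_def_on I K" and Q: "inverse_on I K Q" and i: "i \<in> I"
  shows "(a i)\<^sup>2 \<le> K i i * quad_form_on I Q a"
proof -
  \<comment> \<open>Cauchy-Schwarz for the inner product of \<open>K\<close>, applied to \<open>b = Q a\<close> and the \<open>i\<close>-th unit vector.\<close>
  define b where "b k = (\<Sum>l\<in>I. Q k l * a l)" for k
  define e where "e k = (if k = i then 1 else 0 :: real)" for k
  have sym: "K k l = K l k" if "k \<in> I" "l \<in> I" for k l
    using K that by (auto simp: pos_def_on_def)
  have nonneg: "0 \<le> quad_form_on I K x" for x
  proof (cases "\<exists>i\<in>I. x i \<noteq> 0")
    case True then show ?thesis using K by (auto simp: pos_def_on_def intro: less_imp_le)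
  next
    case False then show ?thesis by (simp add: quad_form_on_def)
  qed
  have Kb: "(\<Sum>l\<in>I. K k l * b l) = a k" if k: "k \<in> I" for k
  proof -
    have "(\<Sum>l\<in>I. K k l * b l) = (\<Sum>l\<in>I. \<Sum>m\<in>I. K k l * Q l m * a m)"
      by (simp add: b_def sum_distrib_left mult.assoc)
    also have "\<dots> = (\<Sum>m\<in>I. (\<Sum>l\<in>I. K k l * Q l m) * a m)"
      by (subst sum.swap) (simp add: sum_distrib_right)
    also have "\<dots> = (\<Sum>m\<in>I. (if k = m then 1 else 0) * a m)"
      using Q k by (intro sum.cong) (auto simp: inverse_on_def)
    also have "\<dots> = a k"
      using I k by (simp add: if_distrib[of "\<lambda>x. x * _"] cong: if_cong)
    finally show ?thesis .
  qed
  have bKb: "quad_form_on I K b = quad_form_on I Q a"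
  proof -
    have "quad_form_on I K b = (\<Sum>k\<in>I. b k * (\<Sum>l\<in>I. K k l * b l))"
      by (simp add: quad_form_on_def sum_distrib_left mult.assoc)
    also have "\<dots> = (\<Sum>k\<in>I. a k * b k)"
      by (intro sum.cong) (auto simp: Kb)
    also have "\<dots> = quad_form_on I Q a"
      by (simp add: quad_form_on_def b_def sum_distrib_left mult.assoc)
    finally show ?thesis .
  qed
  have "0 < quad_form_on I K e"
    using K i by (auto simp: pos_def_on_def e_def)
  also have "quad_form_on I K e = K i i"
    using I i by (simp add: quad_form_on_def e_def if_distrib[of "\<lambda>x. x * _"] if_distrib[of "\<lambda>x. _ * x"]
        cong: if_cong)
  finally have Kii: "0 < K i i" .
  have exp: "quad_form_on I K (\<lambda>k. b k + s * e k) =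
      quad_form_on I K b + 2 * s * a i + s\<^sup>2 * K i i" for s
  proof -
    have "quad_form_on I K (\<lambda>k. b k + s * e k) =
        (\<Sum>k\<in>I. \<Sum>l\<in>I. b k * K k l * b l) + s * (\<Sum>k\<in>I. \<Sum>l\<in>I. e k * K k l * b l)
        + s * (\<Sum>k\<in>I. \<Sum>l\<in>I. b k * K k l * e l) + s\<^sup>2 * (\<Sum>k\<in>I. \<Sum>l\<in>I. e k * K k l * e l)"
      by (simp add: quad_form_on_def sum_distrib_left power2_eq_square algebra_simps
          flip: sum.distrib)
    moreover have "(\<Sum>k\<in>I. \<Sum>l\<in>I. e k * K k l * b l) = a i"
    proof -
      have "(\<Sum>k\<in>I. \<Sum>l\<in>I. e k * K k l * b l) = (\<Sum>k\<in>I. e k * (\<Sum>l\<in>I. K k l * b l))"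
        by (simp add: sum_distrib_left mult.assoc)
      also have "\<dots> = (\<Sum>k\<in>I. e k * a k)"
        by (intro sum.cong) (auto simp: Kb)
      also have "\<dots> = a i"
        using I i by (simp add: e_def if_distrib[of "\<lambda>x. x * _"] cong: if_cong)
      finally show ?thesis .
    qed
    moreover have "(\<Sum>k\<in>I. \<Sum>l\<in>I. b k * K k l * e l) = (\<Sum>k\<in>I. \<Sum>l\<in>I. e k * K k l * b l)"
      by (subst sum.swap) (intro sum.cong refl, simp add: sym mult_ac)
    moreover have "(\<Sum>k\<in>I. \<Sum>l\<in>I. e k * K k l * e l) = K i i"
      using \<open>quad_form_on I K e = K i i\<close> by (simp add: quad_form_on_def)
    ultimately show ?thesis by (simp add: quad_form_on_def)
  qed
  have "0 \<le> quad_form_on I K (\<lambda>k. b k + (- a i / K i i) * e k)"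
    by (rule nonneg)
  also have "\<dots> = quad_form_on I Q a - (a i)\<^sup>2 / K i i"
    using Kii unfolding exp bKb by (simp add: field_simps power2_eq_square)
  finally show ?thesis
    using Kii by (simp add: field_simps)
qed

lemma quad_form_on_le:
  assumes I: "finite I"
  shows "quad_form_on I Q a \<le> (\<Sum>i\<in>I. \<Sum>j\<in>I. \<bar>Q i j\<bar>) * (\<Sum>i\<in>I. (a i)\<^sup>2)"
proof -
  have "a i * Q i j * a j \<le> \<bar>Q i j\<bar> * (\<Sum>i\<in>I. (a i)\<^sup>2)" if ij: "i \<in> I" "j \<in> I" for i j
  proof -
    have le: "(a k)\<^sup>2 \<le> (\<Sum>i\<in>I. (a i)\<^sup>2)" if "k \<in> I" for k
      using I that by (intro member_le_sum) auto
    have "0 \<le> (\<bar>a i\<bar> - \<bar>a j\<bar>)\<^sup>2" by simp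
    also have "\<dots> = (a i)\<^sup>2 + (a j)\<^sup>2 - 2 * (\<bar>a i\<bar> * \<bar>a j\<bar>)"
      by (simp add: power2_diff)
    finally have "\<bar>a i\<bar> * \<bar>a j\<bar> \<le> (\<Sum>i\<in>I. (a i)\<^sup>2)"
      using le[OF ij(1)] le[OF ij(2)] by linarith
    then have "\<bar>Q i j\<bar> * (\<bar>a i\<bar> * \<bar>a j\<bar>) \<le> \<bar>Q i j\<bar> * (\<Sum>i\<in>I. (a i)\<^sup>2)"
      by (rule mult_left_mono) simp
    moreover have "a i * Q i j * a j \<le> \<bar>a i * Q i j * a j\<bar>"
      by (rule abs_ge_self)
    ultimately show ?thesis
      by (simp add: abs_mult mult_ac)
  qed
  then have "quad_form_on I Q a \<le> (\<Sum>i\<in>I. \<Sum>j\<in>I. \<bar>Q i j\<bar> * (\<Sum>i\<in>I. (a i)\<^sup>2))"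
    unfolding quad_form_on_def by (intro sum_mono)
  then show ?thesis by (simp add: sum_distrib_right)
qed

lemma (in prob_space) nondegenerate_gaussian_gaussian_bounds:
  assumes I: "finite I" and Z: "nondegenerate_gaussian M I Z"
  obtains f where "distributed M (lebesgue_on_index I) (subvec Z I) f" "gaussian_bounds I f"
proof -
  obtain \<mu> K Q where K: "pos_def_on I K" and Q: "inverse_on I K Q"
    and D: "distributed M (lebesgue_on_index I) (subvec Z I)
        (\<lambda>z. ennreal (exp (- quad_form_on I Q (\<lambda>i. z i - \<mu> i) / 2) /
               sqrt ((2 * pi) ^ card I * det_on I K)))"
    using Z by (auto simp: nondegenerate_gaussian_def)
  define c where "c = 1 / sqrt ((2 * pi) ^ card I * det_on I K)"
  define f where "f z = ennreal (c * exp (- quad_form_on I Q (\<lambda>i. z i - \<mu> i) / 2))" for z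
  have D: "distributed M (lebesgue_on_index I) (subvec Z I) f"
    using D by (simp add: f_def[abs_def] c_def)
  have "0 < c"
  proof (rule ccontr)
    \<comment> \<open>Otherwise the density vanishes identically.\<close>
    assume "\<not> 0 < c"
    then have "f z = 0" for z
      by (simp add: f_def ennreal_neg mult_nonpos_nonneg)
    then show False
      using distributed_imp_emeasure_nonzero[OF D] by simp
  qed
  define q where "q = (\<Sum>i\<in>I. \<Sum>j\<in>I. \<bar>Q i j\<bar>)"
  define k where "k = (\<Sum>i\<in>I. \<bar>K i i\<bar>)"
  have "0 \<le> q" "0 \<le> k" by (auto simp: q_def k_def intro!: sum_nonneg)
  have up: "quad_form_on I Q (\<lambda>i. z i - \<mu> i) / 2 \<le> (q + 1) * dist_sq_on I \<mu> z" for z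
  proof -
    have "quad_form_on I Q (\<lambda>i. z i - \<mu> i) \<le> q * dist_sq_on I \<mu> z"
      unfolding q_def dist_sq_on_def by (rule quad_form_on_le[OF I])
    moreover have "0 \<le> q * dist_sq_on I \<mu> z" "0 \<le> dist_sq_on I \<mu> z"
      using \<open>0 \<le> q\<close> by (auto simp: dist_sq_on_nonneg)
    ultimately show ?thesis by (simp add: distrib_right)
  qed
  have lo: "1 / (2 * (k + 1)) * dist_sq_on I \<mu> z \<le> quad_form_on I Q (\<lambda>i. z i - \<mu> i) / 2" for z
  proof -
    let ?F = "quad_form_on I Q (\<lambda>i. z i - \<mu> i)"
    have le: "(z i - \<mu> i)\<^sup>2 \<le> K i i * ?F" if "i \<in> I" for i
      using quad_form_on_ge_coordinate[OF I K Q that, of "\<lambda>i. z i - \<mu> i"] by simp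
    have F: "0 \<le> ?F"
    proof (cases "I = {}")
      case False
      then obtain i where i: "i \<in> I" by auto
      have "0 < quad_form_on I K (\<lambda>k. if k = i then 1 else 0)"
        using K i by (auto simp: pos_def_on_def)
      then have "0 < K i i"
        using I i by (simp add: quad_form_on_def if_distrib[of "\<lambda>x. x * _"]
            if_distrib[of "\<lambda>x. _ * x"] cong: if_cong)
      then show ?thesis
        using order_trans[OF zero_le_power2 le[OF i]] by (simp add: zero_le_mult_iff)
    qed (simp add: quad_form_on_def)
    have "dist_sq_on I \<mu> z \<le> (\<Sum>i\<in>I. \<bar>K i i\<bar> * ?F)"
      unfolding dist_sq_on_def
      by (intro sum_mono order_trans[OF le] mult_right_mono F) auto
    also have "\<dots> = k * ?F" by (simp add: k_def sum_distrib_right)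
    also have "\<dots> \<le> (k + 1) * ?F" using F by (simp add: distrib_right)
    finally show ?thesis using \<open>0 \<le> k\<close> by (simp add: field_simps)
  qed
  have "gaussian_bounds I f"
    unfolding gaussian_bounds_def
  proof (intro exI conjI ballI)
    show "0 < c" "0 < q + 1" "0 < c" "0 < 1 / (2 * (k + 1))"
      using \<open>0 < c\<close> \<open>0 \<le> q\<close> \<open>0 \<le> k\<close> by auto
    fix z
    show "ennreal (c * exp (- (q + 1) * dist_sq_on I \<mu> z)) \<le> f z"
      unfolding f_def using up[of z] \<open>0 < c\<close>
      by (intro ennreal_leI mult_left_mono iffD2[OF exp_le_cancel_iff]) linarith+
    show "f z \<le> ennreal (c * exp (- (1 / (2 * (k + 1))) * dist_sq_on I \<mu> z))"
      unfolding f_def using lo[of z] \<open>0 < c\<close>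
      by (intro ennreal_leI mult_left_mono iffD2[OF exp_le_cancel_iff]) linarith+
  qed
  then show ?thesis
    by (rule that[OF D])
qed

section \<open>Factorization of densities under conditional independence\<close>

lemma finite_measure_eqI_rectangles:
  assumes M: "sets M = sets (A \<Otimes>\<^sub>M B)" and N: "sets N = sets (A \<Otimes>\<^sub>M B)"
    and fin: "emeasure M (space M) \<noteq> \<infinity>"
    and eq: "\<And>a b. a \<in> sets A \<Longrightarrow> b \<in> sets B \<Longrightarrow> emeasure M (a \<times> b) = emeasure N (a \<times> b)"
  shows "M = N"
proof (rule measure_eqI_generator_eq[OF Int_stable_pair_measure_generator[of A B],
      where A = "\<lambda>_. space A \<times> space B" and \<Omega> = "space A \<times> space B"])
  show "{a \<times> b |a b. a \<in> sets A \<and> b \<in> sets B} \<subseteq> Pow (space A \<times> space B)"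
    using sets.space_closed[of A] sets.space_closed[of B] by auto
  show "emeasure M (space A \<times> space B) \<noteq> \<infinity>"
    using fin sets_eq_imp_space_eq[OF M] by (simp add: space_pair_measure)
qed (use M N eq in \<open>auto simp: sets_pair_measure\<close>)

lemma finite_measure_eqI_triple_rectangles:
  assumes M: "sets M = sets (A \<Otimes>\<^sub>M (B \<Otimes>\<^sub>M C))" and N: "sets N = sets (A \<Otimes>\<^sub>M (B \<Otimes>\<^sub>M C))"
    and fin: "emeasure M (space M) \<noteq> \<infinity>"
    and eq: "\<And>a b c. a \<in> sets A \<Longrightarrow> b \<in> sets B \<Longrightarrow> c \<in> sets C \<Longrightarrow>
      emeasure M (a \<times> b \<times> c) = emeasure N (a \<times> b \<times> c)"
  shows "M = N"
proof (rule finite_measure_eqI_rectangles[OF M N fin])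
  fix a h assume a: "a \<in> sets A" and h: "h \<in> sets (B \<Otimes>\<^sub>M C)"
  define slice where "slice K = distr (density K (indicator (a \<times> space (B \<Otimes>\<^sub>M C)))) (B \<Otimes>\<^sub>M C) snd"
    for K :: "('a \<times> 'b \<times> 'c) measure"
  have slice: "emeasure (slice K) h = emeasure K (a \<times> h)"
    if K: "sets K = sets (A \<Otimes>\<^sub>M (B \<Otimes>\<^sub>M C))" and h: "h \<in> sets (B \<Otimes>\<^sub>M C)" for K h
  proof -
    have sp: "space K = space A \<times> space (B \<Otimes>\<^sub>M C)"
      using sets_eq_imp_space_eq[OF K] by (simp add: space_pair_measure)
    have [measurable]: "snd \<in> measurable K (B \<Otimes>\<^sub>M C)"
      using K by (simp cong: measurable_cong_sets)
    have [measurable]: "a \<times> space (B \<Otimes>\<^sub>M C) \<in> sets K"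
      using K a by simp
    have [measurable]: "a \<times> h \<in> sets K"
      using K a h by simp
    note [measurable] = h
    have "emeasure (slice K) h = (\<integral>\<^sup>+x. indicator (a \<times> space (B \<Otimes>\<^sub>M C)) x *
        indicator (snd -` h \<inter> space K) x \<partial>K)"
      by (simp add: slice_def emeasure_distr emeasure_density)
    also have "\<dots> = (\<integral>\<^sup>+x. indicator (a \<times> h) x \<partial>K)"
      using sets.sets_into_space[OF h] by (intro nn_integral_cong) (auto simp: indicator_def sp)
    finally show ?thesis by simp
  qed
  have "slice M = slice N"
  proof (rule finite_measure_eqI_rectangles[of _ B C])
    have "emeasure M (a \<times> space (B \<Otimes>\<^sub>M C)) \<le> emeasure M (space M)"
      by (rule emeasure_space)
    then have "emeasure M (a \<times> space (B \<Otimes>\<^sub>M C)) \<noteq> \<infinity>"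
      using fin by (auto simp: top_unique)
    then show "emeasure (slice M) (space (slice M)) \<noteq> \<infinity>"
      using slice[OF M sets.top] by (simp add: slice_def)
    fix b c assume "b \<in> sets B" "c \<in> sets C"
    then show "emeasure (slice M) (b \<times> c) = emeasure (slice N) (b \<times> c)"
      using a by (simp add: slice M N eq)
  qed (simp_all add: slice_def)
  then show "emeasure M (a \<times> h) = emeasure N (a \<times> h)"
    using slice[OF M h] slice[OF N h] by simp
qed

lemma subalgebra_vimage_algebra:
  assumes W: "W \<in> measurable M T"
  shows "subalgebra M (vimage_algebra (space M) W T)"
proof -
  have "W \<in> space M \<rightarrow> space T"
    using W by (auto simp: measurable_def)
  then show ?thesis
    using W by (auto simp: subalgebra_def sets_vimage_algebra2)
qed

lemma (in prob_space) ennreal_cond_prob: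
  assumes W[measurable]: "W \<in> measurable M T" and A[measurable]: "A \<in> sets M"
  shows "AE \<omega> in M. 0 \<le> cond_prob M T W A \<omega> \<and>
    ennreal (cond_prob M T W A \<omega>) = nn_cond_exp M (vimage_algebra (space M) W T) (indicator A) \<omega>"
proof -
  let ?F = "vimage_algebra (space M) W T"
  have "subalgebra M ?F"
    using \<open>W \<in> measurable M T\<close> by (rule subalgebra_vimage_algebra)
  then interpret finite_measure_subalgebra M ?F
    by unfold_locales
  have zero: "AE \<omega> in M. nn_cond_exp M ?F (\<lambda>\<omega>. ennreal (- indicator A \<omega>)) \<omega> = 0"
    using nn_cond_exp_F_meas[of "\<lambda>_. 0"] by (auto simp: ennreal_neg)
  have "(\<integral>\<^sup>+\<omega>. 1 * nn_cond_exp M ?F (indicator A) \<omega> \<partial>M) = (\<integral>\<^sup>+\<omega>. 1 * indicator A \<omega> \<partial>M)"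
    by (rule nn_cond_exp_intg) auto
  then have "(\<integral>\<^sup>+\<omega>. nn_cond_exp M ?F (indicator A) \<omega> \<partial>M) \<noteq> \<infinity>"
    by simp
  then have "AE \<omega> in M. nn_cond_exp M ?F (indicator A) \<omega> \<noteq> \<infinity>"
    by (intro nn_integral_PInf_AE) auto
  with zero show ?thesis
    by eventually_elim (simp add: cond_prob_def real_cond_exp_def less_top ennreal_indicator)
qed

lemma (in prob_space) nn_integral_cond_prob:
  assumes W[measurable]: "W \<in> measurable M T" and A[measurable]: "A \<in> sets M"
    and G[measurable]: "G \<in> sets T"
  shows "(\<integral>\<^sup>+\<omega>. indicator G (W \<omega>) * ennreal (cond_prob M T W A \<omega>) \<partial>M) =
    emeasure M (A \<inter> (W -` G \<inter> space M))"
proof -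
  let ?F = "vimage_algebra (space M) W T"
  have "subalgebra M ?F"
    using \<open>W \<in> measurable M T\<close> by (rule subalgebra_vimage_algebra)
  then interpret finite_measure_subalgebra M ?F
    by unfold_locales
  have [measurable]: "W \<in> measurable ?F T"
    using W by (intro measurable_vimage_algebra1) (auto simp: measurable_def)
  have "(\<integral>\<^sup>+\<omega>. indicator G (W \<omega>) * ennreal (cond_prob M T W A \<omega>) \<partial>M) =
      (\<integral>\<^sup>+\<omega>. indicator G (W \<omega>) * nn_cond_exp M ?F (indicator A) \<omega> \<partial>M)"
    using ennreal_cond_prob[OF W A] by (intro nn_integral_cong_AE) auto
  also have "\<dots> = (\<integral>\<^sup>+\<omega>. indicator G (W \<omega>) * indicator A \<omega> \<partial>M)"
    by (rule nn_cond_exp_intg) measurable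
  also have "\<dots> = (\<integral>\<^sup>+\<omega>. indicator (A \<inter> (W -` G \<inter> space M)) \<omega> \<partial>M)"
    by (intro nn_integral_cong) (auto simp: indicator_def)
  finally show ?thesis by simp
qed

lemma (in prob_space) cond_prob_density:
  assumes S: "sigma_finite_measure S" and T: "sigma_finite_measure T"
    and XW: "distributed M (S \<Otimes>\<^sub>M T) (\<lambda>\<omega>. (X \<omega>, W \<omega>)) f"
    and W: "distributed M T W g"
    and pos: "\<And>w. w \<in> space T \<Longrightarrow> 0 < g w \<and> g w < \<infinity>"
    and E[measurable]: "E \<in> sets S"
  shows "AE \<omega> in M. 0 \<le> cond_prob M T W (X -` E \<inter> space M) \<omega> \<and>
    ennreal (cond_prob M T W (X -` E \<inter> space M) \<omega>) =
    (\<integral>\<^sup>+x. f (x, W \<omega>) * indicator E x \<partial>S) / g (W \<omega>)"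
proof -
  interpret S: sigma_finite_measure S by fact
  interpret T: sigma_finite_measure T by fact
  interpret ST: pair_sigma_finite S T ..
  have [measurable]: "W \<in> measurable M T" "g \<in> borel_measurable T"
    "f \<in> borel_measurable (S \<Otimes>\<^sub>M T)" "(\<lambda>\<omega>. (X \<omega>, W \<omega>)) \<in> measurable M (S \<Otimes>\<^sub>M T)"
    using W XW by (auto simp: distributed_def)
  have [measurable]: "X \<in> measurable M S"
    using measurable_fst'[of "\<lambda>\<omega>. (X \<omega>, W \<omega>)" M S T] by simp
  define q where "q w = (\<integral>\<^sup>+x. f (x, w) * indicator E x \<partial>S)" for w
  have [measurable]: "q \<in> borel_measurable T"
    unfolding q_def by measurable
  let ?F = "vimage_algebra (space M) W T"
  have "subalgebra M ?F"
    using \<open>W \<in> measurable M T\<close> by (rule subalgebra_vimage_algebra)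
  then interpret finite_measure_subalgebra M ?F
    by unfold_locales
  have W_space: "W \<in> space M \<rightarrow> space T"
    using \<open>W \<in> measurable M T\<close> by (auto simp: measurable_def)
  then have [measurable]: "W \<in> measurable ?F T"
    by (rule measurable_vimage_algebra1)
  have "AE \<omega> in M. q (W \<omega>) / g (W \<omega>) = nn_cond_exp M ?F (indicator (X -` E \<inter> space M)) \<omega>"
  proof (rule nn_cond_exp_charact)
    fix A assume "A \<in> sets ?F"
    then obtain G where A: "A = W -` G \<inter> space M" and G[measurable]: "G \<in> sets T"
      by (auto simp: sets_vimage_algebra2[OF W_space])
    have "(\<integral>\<^sup>+\<omega>\<in>A. indicator (X -` E \<inter> space M) \<omega> \<partial>M) =
        (\<integral>\<^sup>+\<omega>. indicator (E \<times> G) (X \<omega>, W \<omega>) \<partial>M)"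
      by (intro nn_integral_cong) (auto simp: A indicator_def)
    also have "\<dots> = (\<integral>\<^sup>+z. f z * indicator (E \<times> G) z \<partial>(S \<Otimes>\<^sub>M T))"
      by (rule distributed_nn_integral[OF XW, symmetric]) measurable
    also have "\<dots> = (\<integral>\<^sup>+w. \<integral>\<^sup>+x. f (x, w) * indicator (E \<times> G) (x, w) \<partial>S \<partial>T)"
      by (rule ST.nn_integral_snd[symmetric]) measurable
    also have "\<dots> = (\<integral>\<^sup>+w. g w * (q w / g w * indicator G w) \<partial>T)"
    proof (rule nn_integral_cong)
      fix w assume w: "w \<in> space T"
      have "(\<integral>\<^sup>+x. f (x, w) * indicator (E \<times> G) (x, w) \<partial>S) =
          (\<integral>\<^sup>+x. f (x, w) * indicator E x * indicator G w \<partial>S)"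
        by (intro nn_integral_cong) (auto simp: indicator_def)
      also have "\<dots> = q w * indicator G w"
        using w unfolding q_def by (subst nn_integral_multc) auto
      also have "\<dots> = g w * (q w / g w * indicator G w)"
      proof -
        have "g w * (q w / g w) = q w"
          using pos[OF w] by (metis ennreal_mult_divide_eq ennreal_times_divide infinity_ennreal_def less_irrefl mult.commute)
        then show ?thesis by (metis mult.assoc)
      qed
      finally show "(\<integral>\<^sup>+x. f (x, w) * indicator (E \<times> G) (x, w) \<partial>S) =
          g w * (q w / g w * indicator G w)" .
    qed
    also have "\<dots> = (\<integral>\<^sup>+\<omega>. q (W \<omega>) / g (W \<omega>) * indicator G (W \<omega>) \<partial>M)"
      by (rule distributed_nn_integral[OF W]) measurable
    also have "\<dots> = (\<integral>\<^sup>+\<omega>\<in>A. q (W \<omega>) / g (W \<omega>) \<partial>M)"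
      by (intro nn_integral_cong) (auto simp: A indicator_def)
    finally show "(\<integral>\<^sup>+\<omega>\<in>A. indicator (X -` E \<inter> space M) \<omega> \<partial>M) =
        (\<integral>\<^sup>+\<omega>\<in>A. q (W \<omega>) / g (W \<omega>) \<partial>M)" .
  qed measurable
  moreover have "AE \<omega> in M. 0 \<le> cond_prob M T W (X -` E \<inter> space M) \<omega> \<and>
    ennreal (cond_prob M T W (X -` E \<inter> space M) \<omega>) =
    nn_cond_exp M ?F (indicator (X -` E \<inter> space M)) \<omega>"
    by (rule ennreal_cond_prob) measurable
  ultimately show ?thesis
    by eventually_elim (simp add: q_def)
qed

lemma (in prob_space) distributed_cond_indep:
  assumes S: "sigma_finite_measure S" and R: "sigma_finite_measure R" and T: "sigma_finite_measure T"
    and XW: "distributed M (S \<Otimes>\<^sub>M T) (\<lambda>\<omega>. (X \<omega>, W \<omega>)) f"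
    and YW: "distributed M (R \<Otimes>\<^sub>M T) (\<lambda>\<omega>. (Y \<omega>, W \<omega>)) h"
    and W: "distributed M T W g"
    and pos: "\<And>w. w \<in> space T \<Longrightarrow> 0 < g w \<and> g w < \<infinity>"
    and indep: "\<And>E F. E \<in> sets S \<Longrightarrow> F \<in> sets R \<Longrightarrow> AE \<omega> in M.
      cond_prob M T W ((X -` E \<inter> space M) \<inter> (Y -` F \<inter> space M)) \<omega> =
      cond_prob M T W (X -` E \<inter> space M) \<omega> * cond_prob M T W (Y -` F \<inter> space M) \<omega>"
  shows "distributed M (S \<Otimes>\<^sub>M (R \<Otimes>\<^sub>M T)) (\<lambda>\<omega>. (X \<omega>, Y \<omega>, W \<omega>))
    (\<lambda>(x, y, w). f (x, w) * h (y, w) / g w)"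
proof -
  interpret S: sigma_finite_measure S by fact
  interpret T: sigma_finite_measure T by fact
  interpret R: sigma_finite_measure R by fact
  interpret ST: pair_sigma_finite S T ..
  interpret RT: pair_sigma_finite R T ..
  have [measurable]: "W \<in> measurable M T" "g \<in> borel_measurable T"
    "f \<in> borel_measurable (S \<Otimes>\<^sub>M T)" "(\<lambda>\<omega>. (X \<omega>, W \<omega>)) \<in> measurable M (S \<Otimes>\<^sub>M T)"
    "h \<in> borel_measurable (R \<Otimes>\<^sub>M T)" "(\<lambda>\<omega>. (Y \<omega>, W \<omega>)) \<in> measurable M (R \<Otimes>\<^sub>M T)"
    using W XW YW by (auto simp: distributed_def)
  have [measurable]: "X \<in> measurable M S" "Y \<in> measurable M R"
    using measurable_fst'[of "\<lambda>\<omega>. (X \<omega>, W \<omega>)" M S T] measurable_fst'[of "\<lambda>\<omega>. (Y \<omega>, W \<omega>)" M R T]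
    by simp_all
  let ?V = "S \<Otimes>\<^sub>M (R \<Otimes>\<^sub>M T)" and ?d = "\<lambda>(x, y, w). f (x, w) * h (y, w) / g w"
  have [measurable]: "?d \<in> borel_measurable ?V"
    by measurable
  have "distr M ?V (\<lambda>\<omega>. (X \<omega>, Y \<omega>, W \<omega>)) = density ?V ?d"
  proof (rule finite_measure_eqI_triple_rectangles[of _ S R T])
    interpret D: prob_space "distr M ?V (\<lambda>\<omega>. (X \<omega>, Y \<omega>, W \<omega>))"
      by (rule prob_space_distr) measurable
    show "emeasure (distr M ?V (\<lambda>\<omega>. (X \<omega>, Y \<omega>, W \<omega>))) (space (distr M ?V (\<lambda>\<omega>. (X \<omega>, Y \<omega>, W \<omega>)))) \<noteq> \<infinity>"
      by (simp only: D.emeasure_space_1) simp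
    fix E F G assume [measurable]: "E \<in> sets S" "F \<in> sets R" "G \<in> sets T"
    define q where "q w = (\<integral>\<^sup>+x. f (x, w) * indicator E x \<partial>S)" for w
    define r where "r w = (\<integral>\<^sup>+y. h (y, w) * indicator F y \<partial>R)" for w
    have [measurable]: "q \<in> borel_measurable T" "r \<in> borel_measurable T"
      unfolding q_def r_def by measurable
    let ?XE = "X -` E \<inter> space M" and ?YF = "Y -` F \<inter> space M"
    have "emeasure (distr M ?V (\<lambda>\<omega>. (X \<omega>, Y \<omega>, W \<omega>))) (E \<times> F \<times> G) =
        emeasure M ((\<lambda>\<omega>. (X \<omega>, Y \<omega>, W \<omega>)) -` (E \<times> F \<times> G) \<inter> space M)"
      by (rule emeasure_distr) measurable
    also have "(\<lambda>\<omega>. (X \<omega>, Y \<omega>, W \<omega>)) -` (E \<times> F \<times> G) \<inter> space M =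
        (?XE \<inter> ?YF) \<inter> (W -` G \<inter> space M)"
      by auto
    also have "emeasure M \<dots> =
        (\<integral>\<^sup>+\<omega>. indicator G (W \<omega>) * ennreal (cond_prob M T W (?XE \<inter> ?YF) \<omega>) \<partial>M)"
      by (rule nn_integral_cond_prob[symmetric]) measurable
    also have "\<dots> = (\<integral>\<^sup>+\<omega>. indicator G (W \<omega>) * (q (W \<omega>) / g (W \<omega>) * (r (W \<omega>) / g (W \<omega>))) \<partial>M)"
    proof (rule nn_integral_cong_AE)
      have "AE \<omega> in M. cond_prob M T W (?XE \<inter> ?YF) \<omega> =
          cond_prob M T W ?XE \<omega> * cond_prob M T W ?YF \<omega>"
        by (rule indep) measurable
      moreover have "AE \<omega> in M. 0 \<le> cond_prob M T W ?XE \<omega> \<and>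
          ennreal (cond_prob M T W ?XE \<omega>) = q (W \<omega>) / g (W \<omega>)"
        unfolding q_def by (rule cond_prob_density[OF S T XW W pos]) measurable
      moreover have "AE \<omega> in M. 0 \<le> cond_prob M T W ?YF \<omega> \<and>
          ennreal (cond_prob M T W ?YF \<omega>) = r (W \<omega>) / g (W \<omega>)"
        unfolding r_def by (rule cond_prob_density[OF R T YW W pos]) measurable
      ultimately show "AE \<omega> in M. indicator G (W \<omega>) * ennreal (cond_prob M T W (?XE \<inter> ?YF) \<omega>) =
          indicator G (W \<omega>) * (q (W \<omega>) / g (W \<omega>) * (r (W \<omega>) / g (W \<omega>)))"
        by eventually_elim (simp add: ennreal_mult)
    qed
    also have "\<dots> = (\<integral>\<^sup>+w. g w * (indicator G w * (q w / g w * (r w / g w))) \<partial>T)"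
      by (rule distributed_nn_integral[OF W, symmetric]) measurable
    also have "\<dots> = (\<integral>\<^sup>+w. q w * (r w * (indicator G w / g w)) \<partial>T)"
    proof (rule nn_integral_cong)
      fix w assume "w \<in> space T"
      then have "g w * inverse (g w) = 1"
        using pos[of w] by (metis divide_ennreal_def ennreal_divide_self infinity_ennreal_def less_irrefl)
      then show "g w * (indicator G w * (q w / g w * (r w / g w))) = q w * (r w * (indicator G w / g w))"
        by (simp add: divide_ennreal_def mult_ac) (metis mult.left_commute mult_1_right)
    qed
    also have "\<dots> = (\<integral>\<^sup>+w. \<integral>\<^sup>+x. f (x, w) * indicator E x * (r w * (indicator G w / g w)) \<partial>S \<partial>T)"
      unfolding q_def by (intro nn_integral_cong nn_integral_multc[symmetric]) measurable
    also have "\<dots> = (\<integral>\<^sup>+x. \<integral>\<^sup>+w. f (x, w) * indicator E x * (r w * (indicator G w / g w)) \<partial>T \<partial>S)"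
      by (rule ST.Fubini') measurable
    also have "\<dots> = (\<integral>\<^sup>+x. \<integral>\<^sup>+w. \<integral>\<^sup>+y. ?d (x, y, w) * indicator (E \<times> F \<times> G) (x, y, w) \<partial>R \<partial>T \<partial>S)"
    proof (intro nn_integral_cong)
      fix x w assume [measurable]: "x \<in> space S" "w \<in> space T"
      have "f (x, w) * indicator E x * (r w * (indicator G w / g w)) =
          (f (x, w) * indicator E x * (indicator G w / g w)) * (\<integral>\<^sup>+y. h (y, w) * indicator F y \<partial>R)"
        by (simp add: r_def mult_ac)
      also have "\<dots> = (\<integral>\<^sup>+y. (f (x, w) * indicator E x * (indicator G w / g w)) *
          (h (y, w) * indicator F y) \<partial>R)"
        by (rule nn_integral_cmult[symmetric]) measurable
      also have "\<dots> = (\<integral>\<^sup>+y. ?d (x, y, w) * indicator (E \<times> F \<times> G) (x, y, w) \<partial>R)"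
        by (intro nn_integral_cong) (auto simp: indicator_def divide_ennreal_def mult_ac)
      finally show "f (x, w) * indicator E x * (r w * (indicator G w / g w)) = \<dots>" .
    qed
    also have "\<dots> = (\<integral>\<^sup>+x. \<integral>\<^sup>+z. ?d (x, z) * indicator (E \<times> F \<times> G) (x, z) \<partial>(R \<Otimes>\<^sub>M T) \<partial>S)"
    proof (rule nn_integral_cong)
      fix x assume [measurable]: "x \<in> space S"
      show "(\<integral>\<^sup>+w. \<integral>\<^sup>+y. ?d (x, y, w) * indicator (E \<times> F \<times> G) (x, y, w) \<partial>R \<partial>T) =
          (\<integral>\<^sup>+z. ?d (x, z) * indicator (E \<times> F \<times> G) (x, z) \<partial>(R \<Otimes>\<^sub>M T))"
        by (rule RT.nn_integral_snd) measurable
    qed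
    also have "\<dots> = (\<integral>\<^sup>+v. ?d v * indicator (E \<times> F \<times> G) v \<partial>?V)"
      by (rule sigma_finite_measure.nn_integral_fst[OF RT.sigma_finite_measure_axioms]) measurable
    also have "\<dots> = emeasure (density ?V ?d) (E \<times> F \<times> G)"
      by (rule emeasure_density[symmetric]) measurable
    finally show "emeasure (distr M ?V (\<lambda>\<omega>. (X \<omega>, Y \<omega>, W \<omega>))) (E \<times> F \<times> G) =
        emeasure (density ?V ?d) (E \<times> F \<times> G)" .
  qed simp_all
  then show ?thesis
    unfolding distributed_def by (intro conjI) measurable
qed

lemma (in prob_space) cond_indep_density_factorization:
  assumes "sigma_finite_measure S" and "sigma_finite_measure R" and "sigma_finite_measure T"
    and XYW: "distributed M (S \<Otimes>\<^sub>M (R \<Otimes>\<^sub>M T)) (\<lambda>\<omega>. (X \<omega>, Y \<omega>, W \<omega>)) d"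
    and XW: "distributed M (S \<Otimes>\<^sub>M T) (\<lambda>\<omega>. (X \<omega>, W \<omega>)) f"
    and YW: "distributed M (R \<Otimes>\<^sub>M T) (\<lambda>\<omega>. (Y \<omega>, W \<omega>)) h"
    and W: "distributed M T W g"
    and pos: "\<And>w. w \<in> space T \<Longrightarrow> 0 < g w \<and> g w < \<infinity>"
    and indep: "\<And>E F. E \<in> sets S \<Longrightarrow> F \<in> sets R \<Longrightarrow> AE \<omega> in M.
      cond_prob M T W ((X -` E \<inter> space M) \<inter> (Y -` F \<inter> space M)) \<omega> =
      cond_prob M T W (X -` E \<inter> space M) \<omega> * cond_prob M T W (Y -` F \<inter> space M) \<omega>"
  shows "AE \<omega> in M. d (X \<omega>, Y \<omega>, W \<omega>) = f (X \<omega>, W \<omega>) * h (Y \<omega>, W \<omega>) / g (W \<omega>)"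
proof -
  let ?V = "S \<Otimes>\<^sub>M (R \<Otimes>\<^sub>M T)" and ?d = "\<lambda>(x, y, w). f (x, w) * h (y, w) / g w"
  have D: "distributed M ?V (\<lambda>\<omega>. (X \<omega>, Y \<omega>, W \<omega>)) ?d"
    by (rule distributed_cond_indep) fact+
  have [measurable]: "d \<in> borel_measurable ?V" "?d \<in> borel_measurable ?V"
    using XYW D by (auto simp: distributed_def)
  have "AE v in ?V. d v = ?d v"
    by (rule distributed_unique[OF XYW D])
  then have "AE v in ?V. 0 < d v \<longrightarrow> d v = ?d v"
    by eventually_elim simp
  then have "AE \<omega> in M. d (X \<omega>, Y \<omega>, W \<omega>) = ?d (X \<omega>, Y \<omega>, W \<omega>)"
    by (subst distributed_AE2[OF XYW]) measurable
  then show ?thesis by simp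
qed

section \<open>Joint entropies of subvectors\<close>

lemma
  assumes JK: "J \<subseteq> K" and E: "E \<in> sets (lebesgue_on_index J)"
  shows sets_vimage_restrict:
      "(\<lambda>z. restrict z J) -` E \<inter> space (lebesgue_on_index K) \<in> sets (lebesgue_on_index K)"
    and subvec_vimage_restrict:
      "subvec X K -` ((\<lambda>z. restrict z J) -` E \<inter> space (lebesgue_on_index K)) \<inter> space P =
        subvec X J -` E \<inter> space P"
proof -
  show "(\<lambda>z. restrict z J) -` E \<inter> space (lebesgue_on_index K) \<in> sets (lebesgue_on_index K)"
    using JK E by (intro measurable_sets[OF measurable_restrict_subset])
  have "restrict (subvec X K \<omega>) J = subvec X J \<omega>" for \<omega>
    using JK by (auto simp: subvec_def restrict_def fun_eq_iff)
  then show "subvec X K -` ((\<lambda>z. restrict z J) -` E \<inter> space (lebesgue_on_index K)) \<inter> space P =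
      subvec X J -` E \<inter> space P"
    by (auto simp: subvec_def space_PiM)
qed

lemma cond_indep_subset:
  assumes indep: "cond_indep P A X B Y C W" and A': "A' \<subseteq> A" and B': "B' \<subseteq> B"
  shows "cond_indep P A' X B' Y C W"
  unfolding cond_indep_def
proof (intro ballI)
  fix E F assume E: "E \<in> sets (lebesgue_on_index A')" and F: "F \<in> sets (lebesgue_on_index B')"
  show "let XE = subvec X A' -` E \<inter> space P; YF = subvec Y B' -` F \<inter> space P;
        cp = cond_prob P (lebesgue_on_index C) (subvec W C)
      in AE \<omega> in P. cp (XE \<inter> YF) \<omega> = cp XE \<omega> * cp YF \<omega>"
    using indep[unfolded cond_indep_def, rule_format, OF sets_vimage_restrict[OF A' E]
        sets_vimage_restrict[OF B' F]]
    unfolding subvec_vimage_restrict[OF A' E] subvec_vimage_restrict[OF B' F] .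
qed

locale gaussian_bounded_vector = prob_space M for M :: "'a measure" +
  fixes I :: "'i set" and Z :: "'i \<Rightarrow> 'a \<Rightarrow> real" and dens :: "'i set \<Rightarrow> ('i \<Rightarrow> real) \<Rightarrow> ennreal"
  assumes finite_index: "finite I"
    and distributed_dens: "K \<subseteq> I \<Longrightarrow> distributed M (lebesgue_on_index K) (subvec Z K) (dens K)"
    and gaussian_bounds_dens: "K \<subseteq> I \<Longrightarrow> gaussian_bounds K (dens K)"
begin

definition log_dens :: "'i set \<Rightarrow> 'a \<Rightarrow> real"
  where "log_dens K \<omega> = ln (enn2real (dens K (subvec Z K \<omega>)))"

definition joint_entropy :: "'i set \<Rightarrow> real"
  where "joint_entropy K = - (\<integral>\<omega>. log_dens K \<omega> \<partial>M)"

lemma integrable_log_dens: "K \<subseteq> I \<Longrightarrow> integrable M (log_dens K)"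
  unfolding log_dens_def[abs_def]
  by (rule gaussian_bounds_integrable_ln[OF finite_subset[OF _ finite_index] distributed_dens
        gaussian_bounds_dens])

lemma transported_density:
  assumes K: "K \<subseteq> I" and iso: "measure_iso (lebesgue_on_index K) S \<phi> \<psi>"
    and X: "\<And>\<omega>. \<omega> \<in> space M \<Longrightarrow> \<phi> (subvec Z K \<omega>) = X \<omega>"
  obtains d :: "'b \<Rightarrow> real" where "distributed M S X d" "\<And>s. s \<in> space S \<Longrightarrow> 0 < d s"
    "\<And>\<omega>. \<omega> \<in> space M \<Longrightarrow> ln (d (X \<omega>)) = log_dens K \<omega>"
proof -
  have D: "distributed M S (\<lambda>\<omega>. \<phi> (subvec Z K \<omega>)) (\<lambda>s. dens K (\<psi> s))"
    by (rule distributed_measure_iso[OF distributed_dens[OF K] iso])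
  have \<psi>: "\<psi> \<in> measurable S (lebesgue_on_index K)"
    and inv: "\<And>z. z \<in> space (lebesgue_on_index K) \<Longrightarrow> \<psi> (\<phi> z) = z"
    using iso by (auto simp: measure_iso_def)
  have [measurable]: "(\<lambda>s. dens K (\<psi> s)) \<in> borel_measurable S"
    using D by (simp add: distributed_def)
  define d where "d s = enn2real (dens K (\<psi> s))" for s
  have d: "ennreal (d s) = dens K (\<psi> s)" "0 < d s" if "s \<in> space S" for s
    using gaussian_bounds_pos_finite[OF gaussian_bounds_dens[OF K], of "\<psi> s"]
      measurable_space[OF \<psi> that]
    by (auto simp: d_def enn2real_positive_iff)
  have [measurable]: "d \<in> borel_measurable S"
    unfolding d_def[abs_def] by measurable
  have "distributed M S (\<lambda>\<omega>. \<phi> (subvec Z K \<omega>)) d"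
  proof -
    have "density S (\<lambda>s. dens K (\<psi> s)) = density S d"
      by (intro density_cong AE_I2) (simp_all add: d(1))
    then show ?thesis
      using D by (simp add: distributed_def)
  qed
  moreover have "distr M S (\<lambda>\<omega>. \<phi> (subvec Z K \<omega>)) = distr M S X"
    by (intro distr_cong) (auto simp: X)
  moreover have "(\<lambda>\<omega>. \<phi> (subvec Z K \<omega>)) \<in> measurable M S \<longleftrightarrow> X \<in> measurable M S"
    by (intro measurable_cong X)
  ultimately have "distributed M S X d"
    by (simp add: distributed_def)
  moreover have "ln (d (X \<omega>)) = log_dens K \<omega>" if "\<omega> \<in> space M" for \<omega>
  proof -
    have "subvec Z K \<omega> \<in> space (lebesgue_on_index K)"
      by (simp add: subvec_def space_PiM)
    then show ?thesis
      using inv by (simp add: d_def log_dens_def X[OF that, symmetric])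
  qed
  ultimately show ?thesis
    using d(2) by (intro that[of d])
qed

lemma single_density:
  assumes A: "finite A" and p: "inj_on p A" "p ` A \<subseteq> I"
  obtains d :: "('j \<Rightarrow> real) \<Rightarrow> real" where
    "distributed M (lebesgue_on_index A) (subvec (\<lambda>i. Z (p i)) A) d"
    "\<And>x. x \<in> space (lebesgue_on_index A) \<Longrightarrow> 0 < d x"
    "\<And>\<omega>. \<omega> \<in> space M \<Longrightarrow> ln (d (subvec (\<lambda>i. Z (p i)) A \<omega>)) = log_dens (p ` A) \<omega>"
  by (rule transported_density[OF p(2) measure_iso_reindex[OF A p(1)],
        of "subvec (\<lambda>i. Z (p i)) A"])
    (use that in \<open>auto simp: subvec_def restrict_def fun_eq_iff\<close>)

lemma pair_density:
  assumes A: "finite A" and p: "inj_on p A" "p ` A \<subseteq> I"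
    and B: "finite B" and q: "inj_on q B" "q ` B \<subseteq> I" and disj: "p ` A \<inter> q ` B = {}"
  obtains d :: "('j \<Rightarrow> real) \<times> ('k \<Rightarrow> real) \<Rightarrow> real" where
    "distributed M (lebesgue_on_index A \<Otimes>\<^sub>M lebesgue_on_index B)
      (\<lambda>\<omega>. (subvec (\<lambda>i. Z (p i)) A \<omega>, subvec (\<lambda>j. Z (q j)) B \<omega>)) d"
    "\<And>s. s \<in> space (lebesgue_on_index A \<Otimes>\<^sub>M lebesgue_on_index B) \<Longrightarrow> 0 < d s"
    "\<And>\<omega>. \<omega> \<in> space M \<Longrightarrow> ln (d (subvec (\<lambda>i. Z (p i)) A \<omega>, subvec (\<lambda>j. Z (q j)) B \<omega>)) =
      log_dens (p ` A \<union> q ` B) \<omega>"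
proof -
  have "p ` A \<union> q ` B \<subseteq> I" using p q by auto
  moreover note measure_iso_pair[OF finite_imageI[OF A, of p] finite_imageI[OF B, of q] disj
      measure_iso_reindex[OF A p(1)] measure_iso_reindex[OF B q(1)]
      sigma_finite_lebesgue_on_index[OF A] sigma_finite_lebesgue_on_index[OF B]]
  ultimately show ?thesis
    by (rule transported_density[where X = "\<lambda>\<omega>. (subvec (\<lambda>i. Z (p i)) A \<omega>, subvec (\<lambda>j. Z (q j)) B \<omega>)"])
      (use that in \<open>auto simp: subvec_def restrict_def fun_eq_iff\<close>)
qed

lemma triple_density:
  assumes A: "finite A" and p: "inj_on p A" "p ` A \<subseteq> I"
    and B: "finite B" and q: "inj_on q B" "q ` B \<subseteq> I"
    and C: "finite C" and r: "inj_on r C" "r ` C \<subseteq> I"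
    and disj: "p ` A \<inter> q ` B = {}" "p ` A \<inter> r ` C = {}" "q ` B \<inter> r ` C = {}"
  obtains d :: "('j \<Rightarrow> real) \<times> ('k \<Rightarrow> real) \<times> ('l \<Rightarrow> real) \<Rightarrow> real" where
    "distributed M (lebesgue_on_index A \<Otimes>\<^sub>M (lebesgue_on_index B \<Otimes>\<^sub>M lebesgue_on_index C))
      (\<lambda>\<omega>. (subvec (\<lambda>i. Z (p i)) A \<omega>, subvec (\<lambda>j. Z (q j)) B \<omega>, subvec (\<lambda>k. Z (r k)) C \<omega>)) d"
    "\<And>s. s \<in> space (lebesgue_on_index A \<Otimes>\<^sub>M (lebesgue_on_index B \<Otimes>\<^sub>M lebesgue_on_index C)) \<Longrightarrow> 0 < d s"
    "\<And>\<omega>. \<omega> \<in> space M \<Longrightarrow> ln (d (subvec (\<lambda>i. Z (p i)) A \<omega>, subvec (\<lambda>j. Z (q j)) B \<omega>,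
      subvec (\<lambda>k. Z (r k)) C \<omega>)) = log_dens (p ` A \<union> (q ` B \<union> r ` C)) \<omega>"
proof -
  interpret B: sigma_finite_measure "lebesgue_on_index B" by (rule sigma_finite_lebesgue_on_index[OF B])
  interpret C: sigma_finite_measure "lebesgue_on_index C" by (rule sigma_finite_lebesgue_on_index[OF C])
  interpret BC: pair_sigma_finite "lebesgue_on_index B" "lebesgue_on_index C" ..
  have "p ` A \<union> (q ` B \<union> r ` C) \<subseteq> I" using p q r by auto
  moreover have disj': "p ` A \<inter> (q ` B \<union> r ` C) = {}" using disj by auto
  note measure_iso_pair[OF finite_imageI[OF A, of p] finite_UnI[OF finite_imageI[OF B, of q] finite_imageI[OF C, of r]]
      disj' measure_iso_reindex[OF A p(1)]
      measure_iso_pair[OF finite_imageI[OF B, of q] finite_imageI[OF C, of r] disj(3)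
        measure_iso_reindex[OF B q(1)] measure_iso_reindex[OF C r(1)]
        B.sigma_finite_measure_axioms C.sigma_finite_measure_axioms]
      sigma_finite_lebesgue_on_index[OF A] BC.sigma_finite_measure_axioms]
  ultimately show ?thesis
    by (rule transported_density[where X = "\<lambda>\<omega>. (subvec (\<lambda>i. Z (p i)) A \<omega>,
        subvec (\<lambda>j. Z (q j)) B \<omega>, subvec (\<lambda>k. Z (r k)) C \<omega>)"])
      (use that in \<open>auto simp: subvec_def restrict_def fun_eq_iff\<close>)
qed

lemma cond_entropy_eq_joint_entropy:
  assumes A: "finite A" and p: "inj_on p A" "p ` A \<subseteq> I"
    and B: "finite B" and q: "inj_on q B" "q ` B \<subseteq> I" and disj: "p ` A \<inter> q ` B = {}"
  shows "cond_entropy M A (\<lambda>i. Z (p i)) B (\<lambda>j. Z (q j)) =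
    joint_entropy (p ` A \<union> q ` B) - joint_entropy (q ` B)"
proof -
  interpret information_space M "exp 1" by unfold_locales simp
  let ?S = "lebesgue_on_index A" and ?T = "lebesgue_on_index B"
  let ?X = "subvec (\<lambda>i. Z (p i)) A" and ?Y = "subvec (\<lambda>j. Z (q j)) B"
  obtain dxy where xy: "distributed M (?S \<Otimes>\<^sub>M ?T) (\<lambda>\<omega>. (?X \<omega>, ?Y \<omega>)) dxy"
    and xy_pos: "\<And>s. s \<in> space (?S \<Otimes>\<^sub>M ?T) \<Longrightarrow> 0 < dxy s"
    and xy_ln: "\<And>\<omega>. \<omega> \<in> space M \<Longrightarrow> ln (dxy (?X \<omega>, ?Y \<omega>)) = log_dens (p ` A \<union> q ` B) \<omega>"
    by (rule pair_density[OF A p B q disj]) (rule that)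
  obtain dy where y: "distributed M ?T ?Y dy"
    and y_pos: "\<And>x. x \<in> space ?T \<Longrightarrow> 0 < dy x"
    and y_ln: "\<And>\<omega>. \<omega> \<in> space M \<Longrightarrow> ln (dy (?Y \<omega>)) = log_dens (q ` B) \<omega>"
    by (rule single_density[OF B q]) (rule that)
  have nn: "0 \<le> dxy s" if "s \<in> space (?S \<Otimes>\<^sub>M ?T)" for s
    using xy_pos[OF that] by simp
  have nn': "0 \<le> dy x" if "x \<in> space ?T" for x
    using y_pos[OF that] by simp
  have [measurable]: "dxy \<in> borel_measurable (?S \<Otimes>\<^sub>M ?T)"
    using nn xy by (rule distributed_real_measurable)
  have [measurable]: "dy \<in> borel_measurable ?T"
    using nn' y by (rule distributed_real_measurable)
  have "cond_entropy M A (\<lambda>i. Z (p i)) B (\<lambda>j. Z (q j)) =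
      - (\<integral>(x, y). dxy (x, y) * log (exp 1) (dxy (x, y) / dy y) \<partial>(?S \<Otimes>\<^sub>M ?T))"
    unfolding cond_entropy_def
    by (rule conditional_entropy_generic_eq[OF sigma_finite_lebesgue_on_index[OF A]
          sigma_finite_lebesgue_on_index[OF B] y nn' xy nn]) (auto simp: space_pair_measure)
  also have "(\<integral>(x, y). dxy (x, y) * log (exp 1) (dxy (x, y) / dy y) \<partial>(?S \<Otimes>\<^sub>M ?T)) =
      (\<integral>s. dxy s * log (exp 1) (dxy s / dy (snd s)) \<partial>(?S \<Otimes>\<^sub>M ?T))"
    by (simp add: split_beta')
  also have "\<dots> = (\<integral>\<omega>. log (exp 1) (dxy (?X \<omega>, ?Y \<omega>) / dy (snd (?X \<omega>, ?Y \<omega>))) \<partial>M)"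
    by (rule distributed_integral[OF xy _ nn]) measurable
  also have "\<dots> = (\<integral>\<omega>. log_dens (p ` A \<union> q ` B) \<omega> - log_dens (q ` B) \<omega> \<partial>M)"
  proof (rule Bochner_Integration.integral_cong[OF refl])
    fix \<omega> assume \<omega>: "\<omega> \<in> space M"
    have "0 < dxy (?X \<omega>, ?Y \<omega>)" "0 < dy (?Y \<omega>)"
      by (auto intro!: xy_pos y_pos simp: space_pair_measure space_PiM subvec_def)
    then show "log (exp 1) (dxy (?X \<omega>, ?Y \<omega>) / dy (snd (?X \<omega>, ?Y \<omega>))) =
        log_dens (p ` A \<union> q ` B) \<omega> - log_dens (q ` B) \<omega>"
      by (simp add: log_def ln_div xy_ln[OF \<omega>, symmetric] y_ln[OF \<omega>, symmetric])
  qed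
  also have "\<dots> = (\<integral>\<omega>. log_dens (p ` A \<union> q ` B) \<omega> \<partial>M) - (\<integral>\<omega>. log_dens (q ` B) \<omega> \<partial>M)"
    using p q by (intro Bochner_Integration.integral_diff integrable_log_dens) auto
  finally show ?thesis
    by (simp add: joint_entropy_def)
qed

lemma joint_entropy_cond_indep:
  assumes A: "finite A" and p: "inj_on p A" "p ` A \<subseteq> I"
    and B: "finite B" and q: "inj_on q B" "q ` B \<subseteq> I"
    and C: "finite C" and r: "inj_on r C" "r ` C \<subseteq> I"
    and disj: "p ` A \<inter> q ` B = {}" "p ` A \<inter> r ` C = {}" "q ` B \<inter> r ` C = {}"
    and indep: "cond_indep M A (\<lambda>i. Z (p i)) B (\<lambda>j. Z (q j)) C (\<lambda>k. Z (r k))"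
  shows "joint_entropy (p ` A \<union> (q ` B \<union> r ` C)) + joint_entropy (r ` C) =
    joint_entropy (p ` A \<union> r ` C) + joint_entropy (q ` B \<union> r ` C)"
proof -
  let ?S = "lebesgue_on_index A" and ?R = "lebesgue_on_index B" and ?T = "lebesgue_on_index C"
  let ?X = "subvec (\<lambda>i. Z (p i)) A" and ?Y = "subvec (\<lambda>j. Z (q j)) B"
    and ?W = "subvec (\<lambda>k. Z (r k)) C"
  obtain d where d: "distributed M (?S \<Otimes>\<^sub>M (?R \<Otimes>\<^sub>M ?T)) (\<lambda>\<omega>. (?X \<omega>, ?Y \<omega>, ?W \<omega>)) d"
    and d_pos: "\<And>s. s \<in> space (?S \<Otimes>\<^sub>M (?R \<Otimes>\<^sub>M ?T)) \<Longrightarrow> 0 < d s"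
    and d_ln: "\<And>\<omega>. \<omega> \<in> space M \<Longrightarrow>
      ln (d (?X \<omega>, ?Y \<omega>, ?W \<omega>)) = log_dens (p ` A \<union> (q ` B \<union> r ` C)) \<omega>"
    by (rule triple_density[OF A p B q C r disj]) (rule that)
  obtain f where f: "distributed M (?S \<Otimes>\<^sub>M ?T) (\<lambda>\<omega>. (?X \<omega>, ?W \<omega>)) f"
    and f_pos: "\<And>s. s \<in> space (?S \<Otimes>\<^sub>M ?T) \<Longrightarrow> 0 < f s"
    and f_ln: "\<And>\<omega>. \<omega> \<in> space M \<Longrightarrow> ln (f (?X \<omega>, ?W \<omega>)) = log_dens (p ` A \<union> r ` C) \<omega>"
    by (rule pair_density[OF A p C r disj(2)]) (rule that)
  obtain h where h: "distributed M (?R \<Otimes>\<^sub>M ?T) (\<lambda>\<omega>. (?Y \<omega>, ?W \<omega>)) h"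
    and h_pos: "\<And>s. s \<in> space (?R \<Otimes>\<^sub>M ?T) \<Longrightarrow> 0 < h s"
    and h_ln: "\<And>\<omega>. \<omega> \<in> space M \<Longrightarrow> ln (h (?Y \<omega>, ?W \<omega>)) = log_dens (q ` B \<union> r ` C) \<omega>"
    by (rule pair_density[OF B q C r disj(3)]) (rule that)
  obtain g where g: "distributed M ?T ?W g"
    and g_pos: "\<And>x. x \<in> space ?T \<Longrightarrow> 0 < g x"
    and g_ln: "\<And>\<omega>. \<omega> \<in> space M \<Longrightarrow> ln (g (?W \<omega>)) = log_dens (r ` C) \<omega>"
    by (rule single_density[OF C r]) (rule that)
  have "AE \<omega> in M. ennreal (d (?X \<omega>, ?Y \<omega>, ?W \<omega>)) =
      ennreal (f (?X \<omega>, ?W \<omega>)) * ennreal (h (?Y \<omega>, ?W \<omega>)) / ennreal (g (?W \<omega>))"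
  proof (rule cond_indep_density_factorization[OF sigma_finite_lebesgue_on_index[OF A]
        sigma_finite_lebesgue_on_index[OF B] sigma_finite_lebesgue_on_index[OF C] d f h g])
    show "0 < ennreal (g w) \<and> ennreal (g w) < \<infinity>" if "w \<in> space ?T" for w
      using g_pos[OF that] by simp
    show "AE \<omega> in M. cond_prob M ?T ?W ((?X -` E \<inter> space M) \<inter> (?Y -` F \<inter> space M)) \<omega> =
        cond_prob M ?T ?W (?X -` E \<inter> space M) \<omega> * cond_prob M ?T ?W (?Y -` F \<inter> space M) \<omega>"
      if "E \<in> sets ?S" "F \<in> sets ?R" for E F
      using indep that by (simp add: cond_indep_def Let_def)
  qed
  with AE_space have "AE \<omega> in M. log_dens (p ` A \<union> (q ` B \<union> r ` C)) \<omega> =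
      log_dens (p ` A \<union> r ` C) \<omega> + log_dens (q ` B \<union> r ` C) \<omega> - log_dens (r ` C) \<omega>"
  proof eventually_elim
    fix \<omega> assume \<omega>: "\<omega> \<in> space M"
      and eq: "ennreal (d (?X \<omega>, ?Y \<omega>, ?W \<omega>)) =
        ennreal (f (?X \<omega>, ?W \<omega>)) * ennreal (h (?Y \<omega>, ?W \<omega>)) / ennreal (g (?W \<omega>))"
    have pos: "0 < d (?X \<omega>, ?Y \<omega>, ?W \<omega>)" "0 < f (?X \<omega>, ?W \<omega>)" "0 < h (?Y \<omega>, ?W \<omega>)" "0 < g (?W \<omega>)"
      by (auto intro!: d_pos f_pos h_pos g_pos simp: space_pair_measure space_PiM subvec_def)
    then have "d (?X \<omega>, ?Y \<omega>, ?W \<omega>) = f (?X \<omega>, ?W \<omega>) * h (?Y \<omega>, ?W \<omega>) / g (?W \<omega>)"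
      using eq by (simp add: ennreal_mult[symmetric] divide_ennreal)
    then have "ln (d (?X \<omega>, ?Y \<omega>, ?W \<omega>)) =
        ln (f (?X \<omega>, ?W \<omega>)) + ln (h (?Y \<omega>, ?W \<omega>)) - ln (g (?W \<omega>))"
      using pos by (simp add: ln_div ln_mult)
    then show "log_dens (p ` A \<union> (q ` B \<union> r ` C)) \<omega> =
        log_dens (p ` A \<union> r ` C) \<omega> + log_dens (q ` B \<union> r ` C) \<omega> - log_dens (r ` C) \<omega>"
      by (simp add: d_ln[OF \<omega>] f_ln[OF \<omega>] h_ln[OF \<omega>] g_ln[OF \<omega>])
  qed
  moreover have int: "integrable M (log_dens (p ` A \<union> (q ` B \<union> r ` C)))"
    "integrable M (log_dens (p ` A \<union> r ` C))" "integrable M (log_dens (q ` B \<union> r ` C))"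
    "integrable M (log_dens (r ` C))"
    using p q r by (auto intro!: integrable_log_dens)
  ultimately have "(\<integral>\<omega>. log_dens (p ` A \<union> (q ` B \<union> r ` C)) \<omega> \<partial>M) =
      (\<integral>\<omega>. log_dens (p ` A \<union> r ` C) \<omega> + log_dens (q ` B \<union> r ` C) \<omega> - log_dens (r ` C) \<omega> \<partial>M)"
    by (intro integral_cong_AE) auto
  then show ?thesis
    using int by (simp add: joint_entropy_def)
qed

end

lemma measure_iso_refl: "measure_iso M M (\<lambda>z. z) (\<lambda>z. z)"
  by (simp add: measure_iso_def distr_id2)

lemma (in prob_space) nondegenerate_gaussian_imp_gaussian_bounded_vector:
  assumes I: "finite I" and Z: "nondegenerate_gaussian M I Z"
  obtains dens where "gaussian_bounded_vector M I Z dens"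
proof -
  obtain f where f: "distributed M (lebesgue_on_index I) (subvec Z I) f" and bf: "gaussian_bounds I f"
    using nondegenerate_gaussian_gaussian_bounds[OF I Z] .
  define dens where
    "dens K x = (\<integral>\<^sup>+y. f (merge K (I - K) (x, y)) \<partial>lebesgue_on_index (I - K))" for K x
  have "gaussian_bounded_vector M I Z dens"
  proof (unfold_locales)
    show "finite I" by fact
    fix K assume K: "K \<subseteq> I"
    have fin: "finite K" "finite (I - K)" and disj: "K \<inter> (I - K) = {}" and un: "K \<union> (I - K) = I"
      using I K by (auto intro: finite_subset)
    have "subvec Z K \<omega> = restrict (subvec Z I \<omega>) K" "subvec Z (I - K) \<omega> = restrict (subvec Z I \<omega>) (I - K)" for \<omega>
      using K by (auto simp: subvec_def restrict_def fun_eq_iff)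
    moreover have "measure_iso (lebesgue_on_index I) (lebesgue_on_index K \<Otimes>\<^sub>M lebesgue_on_index (I - K))
        (\<lambda>z. (restrict z K, restrict z (I - K))) (\<lambda>(x, y). merge K (I - K) (x, y))"
      using measure_iso_pair[OF fin disj measure_iso_refl measure_iso_refl
          sigma_finite_lebesgue_on_index[OF fin(1)] sigma_finite_lebesgue_on_index[OF fin(2)]]
      by (simp only: un)
    ultimately have "distributed M (lebesgue_on_index K \<Otimes>\<^sub>M lebesgue_on_index (I - K))
        (\<lambda>\<omega>. (subvec Z K \<omega>, subvec Z (I - K) \<omega>)) (\<lambda>s. f (case s of (x, y) \<Rightarrow> merge K (I - K) (x, y)))"
      using distributed_measure_iso[OF f] by simp
    from distr_marginal1[OF sigma_finite_lebesgue_on_index[OF fin(1)]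
        sigma_finite_lebesgue_on_index[OF fin(2)] this]
    show "distributed M (lebesgue_on_index K) (subvec Z K) (dens K)"
      by (simp add: dens_def[abs_def])
    show "gaussian_bounds K (dens K)"
      using gaussian_bounds_marginal[OF fin disj, unfolded un, OF bf] by (simp add: dens_def[abs_def])
  qed
  then show ?thesis by (rule that)
qed

section \<open>The two optimization problems\<close>

theorem mainTheorem4:
  fixes P :: "'a measure"
    and U :: "'u set" and L :: "'u \<Rightarrow> 'a \<Rightarrow> real"
    and V :: "('x \<times> nat) set" and Y :: "'x \<times> nat \<Rightarrow> 'a \<Rightarrow> real"
    and M t N :: nat
  assumes "prob_space P"
    and "finite U" and "finite V"
    and "V = (\<Union>i\<in>{1..M}. of_type V i)"
    and "t \<in> {1..M}"
    and "nondegenerate_gaussian P (U <+> V) (case_sum L Y)"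
    and "\<forall>X. X \<subseteq> V \<longrightarrow> cond_indep P X Y (V - X) Y U L"
    and "1 \<le> N" and "N \<le> card V"
  shows "{X. is_arg_min
            (\<lambda>X. cond_entropy P (of_type V t - of_type X t) Y X Y)
            (\<lambda>X. X \<subseteq> V \<and> card X = N) X} =
         {X. is_arg_max
            (\<lambda>X. cond_entropy P (of_type X t) Y U L
                 - cond_mutual_info P U L Y (of_type V t - of_type X t) X)
            (\<lambda>X. X \<subseteq> V \<and> card X = N) X}"
proof -
  interpret prob_space P by fact
  obtain dens where "gaussian_bounded_vector P (U <+> V) (case_sum L Y) dens"
    using nondegenerate_gaussian_imp_gaussian_bounded_vector[OF finite_Plus[OF assms(2,3)] assms(6)] .
  then interpret gaussian_bounded_vector P "U <+> V" "case_sum L Y" dens .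
  define e where "e C B = joint_entropy (Inl ` C \<union> Inr ` B)" for C :: "'u set" and B :: "('x \<times> nat) set"
  have fin: "finite B" if "B \<subseteq> V" for B
    using assms(3) that by (rule finite_subset[rotated])
  have YY: "cond_entropy P A Y B Y = e {} (A \<union> B) - e {} B"
    if "A \<subseteq> V" "B \<subseteq> V" "A \<inter> B = {}" for A B
    using cond_entropy_eq_joint_entropy[of A Inr B Inr] that fin
    by (auto simp: e_def image_Un inj_on_def Plus_def)
  have LY: "cond_entropy P U L B Y = e U B - e {} B" if "B \<subseteq> V" for B
    using cond_entropy_eq_joint_entropy[of U Inl B Inr] that fin assms(2)
    by (auto simp: e_def inj_on_def Plus_def)
  have YL: "cond_entropy P A Y U L = e U A - e U {}" if "A \<subseteq> V" for A
    using cond_entropy_eq_joint_entropy[of A Inr U Inl] that fin assms(2)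
    by (auto simp: e_def inj_on_def Plus_def Un_commute)
  have indep: "e U (A \<union> B) + e U {} = e U A + e U B" if "A \<subseteq> X" "B \<subseteq> V - X" "X \<subseteq> V" for A B X
  proof -
    have "cond_indep P A Y B Y U L"
      using assms(7) that by (auto intro: cond_indep_subset)
    moreover have "finite A" "finite B"
      using that by (auto intro: fin)
    moreover have "Inr ` A \<subseteq> U <+> V" "Inr ` B \<subseteq> U <+> V" "Inl ` U \<subseteq> U <+> V"
      "Inr ` A \<inter> Inr ` B = ({} :: ('u + 'x \<times> nat) set)"
      using that by auto
    ultimately show ?thesis
      using joint_entropy_cond_indep[of A Inr B Inr U Inl] assms(2)
      by (auto simp: e_def inj_on_def image_Un Un_ac)
  qed
  define H where "H X = cond_entropy P (of_type V t - of_type X t) Y X Y" for X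
  define J where "J X = cond_entropy P (of_type X t) Y U L
      - cond_mutual_info P U L Y (of_type V t - of_type X t) X" for X
  have HJ: "H X = (e U (of_type V t) - e U {}) - J X" if X: "X \<subseteq> V" for X
  proof -
    define A where "A = of_type X t"
    define B where "B = of_type V t - of_type X t"
    have A: "A \<subseteq> X" "A \<subseteq> V" and B: "B \<subseteq> V - X" "B \<subseteq> V" "B \<inter> X = {}"
      and AB: "A \<union> B = of_type V t"
      using X by (auto simp: A_def B_def of_type_def)
    have "H X = e {} (X \<union> B) - e {} X"
      unfolding H_def B_def[symmetric] using YY[OF B(2) X B(3)] by (simp add: Un_commute)
    moreover have "J X = (e U A - e U {}) - ((e U X - e {} X) - (e U (X \<union> B) - e {} (X \<union> B)))"
      unfolding J_def cond_mutual_info_def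
      unfolding B_def[symmetric]
      unfolding A_def[symmetric]
      using A B X by (simp add: YL LY)
    moreover have "e U (of_type V t) + e U {} = e U A + e U B"
      using indep[OF A(1) B(1) X] by (simp add: AB)
    moreover have "e U (X \<union> B) + e U {} = e U X + e U B"
      using indep[OF subset_refl B(1) X] .
    ultimately show ?thesis by simp
  qed
  have "is_arg_min H (\<lambda>X. X \<subseteq> V \<and> card X = N) X \<longleftrightarrow> is_arg_max J (\<lambda>X. X \<subseteq> V \<and> card X = N) X" for X
    unfolding is_arg_min_def is_arg_max_def using HJ by auto
  then show ?thesis
    unfolding H_def J_def by simp
qed

end
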